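(* Let $\phi$ be a finite Blaschke product of order $n$, let $U$ be a small invertible open set of $E$, let $\{\rho_j\}_{j=1}^n$ be a complete collection of local inverses on $U$ with $\rho_1(z)=z$, and extend the $\rho_j$ to $E\setminus\Gamma$ with the orientation $\{\{\rho_j\}_{j=1}^n,U\}$. If $W$ is a unitary operator on the Bergman space $L^2_a$ that commutes with $M_\phi$, then there is a unit vector $(r_1,\dots,r_n)\in\mathbb C^n$ such that for every $\alpha\in U$ $$W^*\begin{pmatrix}\overline{\rho_1'(\alpha)}\,k_{\rho_1(\alpha)}\\ \overline{\rho_2'(\alpha)}\,k_{\rho_2(\alpha)}\\ \vdots\\ \overline{\rho_n'(\alpha)}\,k_{\rho_n(\alpha)}\end{pmatrix}=\Gamma_W\begin{pmatrix}\overline{\rho_1'(\alpha)}\,k_{\rho_1(\alpha)}\\ \overline{\rho_2'(\alpha)}\,k_{\rho_2(\alpha)}\\ \vdots\\ \overline{\rho_n'(\alpha)}\,k_{\rho_n(\alpha)}\end{pmatrix}$$ (with $W^*$ applied entrywise), where $\Gamma_W$ is the following $n\times n$ unitary matrix: $$\Gamma_W=\begin{pmatrix} r_1&r_2&\cdots&r_n\\ r_{\pi_2^{-1}(1)}&r_{\pi_2^{-1}(2)}&\cdots&r_{\pi_2^{-1}(n)}\\ \vdots&\vdots&&\vdots\\ r_{\pi_n^{-1}(1)}&r_{\pi_n^{-1}(2)}&\cdots&r_{\pi_n^{-1}(n)}\end{pmatrix}.$$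
   Context: $\mathbb D$ is the open unit disk; $L^2_a$ is the Bergman space of analytic functions in $L^2(\mathbb D,dA)$, $dA$ normalized area measure; $k_\alpha$ is its reproducing kernel at $\alpha\in\mathbb D$. A Blaschke product of order $n$ is $\phi(z)=\prod_{j=1}^n\frac{z-a_j}{1-\overline{a}_jz}$, $a_j\in\mathbb D$, and $M_\phi h=\phi h$ on $L^2_a$. Let $\mathcal C$ be the (finite) set of critical points of $\phi$ in $\mathbb D$, $\mathcal F=\mathbb D\cap\phi^{-1}(\phi(\mathcal C))$ (finite) and $E=\mathbb D\setminus\mathcal F$. A local inverse of $\phi$ on an open set $V\subset\mathbb D$ is an analytic $\rho:V\to\mathbb D$ with $\phi\circ\rho=\phi$ on $V$. A finite collection $\{f_i\}$ of local inverses on $V$ is complete if for each $z\in V$, $\phi^{-1}(\phi(z))\cap\mathbb D\subset\{f_i(z)\}$ and $f_i(z)\ne f_j(z)$ for $i\neq j$; $V$ is invertible if such a collection exists. A small invertible open set $U$ of $E$ is an invertible open disc $U\subset E$ such that the sets $\rho_1(U),\dots,\rho_n(U)$ are pairwise disjoint. $\Gamma$ is a curve through all the points of $\mathcal F$ and connecting to a point of the unit circle, such that $E\setminus\Gamma$ is simply connected and $\Gamma$ is disjoint from $\bigcup_{j=1}^n\rho_j(U)$. Each $\rho_j$ can be continued analytically along every curve in $E$, hence extends from $U$ to a unique analytic function on $E\setminus\Gamma$, still denoted $\rho_j$, satisfying $\phi\circ\rho_j=\phi$; this global labelling is called the orientation $\{\{\rho_j\}_{j=1}^n,U\}$. For each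 $i,k\in\{1,\dots,n\}$ the composition $\rho_k\circ\rho_i$ is defined on $U$ and equals $\rho_{\pi_i(k)}$ on $U$ for a unique index $\pi_i(k)$, and $k\mapsto\pi_i(k)$ is a permutation $\pi_i$ of $\{1,\dots,n\}$ (with $\pi_1$ the identity). *)

theory Defs
  imports "HOL-Analysis.Analysis"
begin

subsection \<open>The Bergman space of the unit disc\<close>

text \<open>Normalized area measure on the open unit disc.\<close>

definition disc_area :: "complex measure" where
  "disc_area = uniform_measure lborel (ball 0 1)"

text \<open>An element of the space is a function on the disc.  It is represented by its extension by 0
  to the whole plane, so that equality of elements is equality of HOL functions.\<close>

definition bergman_space :: "(complex \<Rightarrow> complex) set" where
  "bergman_space =
     {f. f holomorphic_on ball 0 1 \<and> integrable disc_area (\<lambda>z. (norm (f z))\<^sup>2) \<and>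
         (\<forall>z. z \<notin> ball 0 1 \<longrightarrow> f z = 0)}"

definition bergman_inner :: "(complex \<Rightarrow> complex) \<Rightarrow> (complex \<Rightarrow> complex) \<Rightarrow> complex" where
  "bergman_inner f g = (\<integral>z. f z * cnj (g z) \<partial>disc_area)"

definition bergman_kernel :: "complex \<Rightarrow> complex \<Rightarrow> complex" where
  "bergman_kernel \<alpha> =
     (THE k. k \<in> bergman_space \<and> (\<forall>f\<in>bergman_space. f \<alpha> = bergman_inner f k))"

text \<open>Operators on the space are maps on all HOL functions; only their values on
  \<^const>\<open>bergman_space\<close> are relevant.\<close>

definition mult_operator ::
    "(complex \<Rightarrow> complex) \<Rightarrow> (complex \<Rightarrow> complex) \<Rightarrow> complex \<Rightarrow> complex" where
  "mult_operator \<phi> h = (\<lambda>z. \<phi> z * h z)"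

definition bergman_linear :: "((complex \<Rightarrow> complex) \<Rightarrow> complex \<Rightarrow> complex) \<Rightarrow> bool" where
  "bergman_linear W \<longleftrightarrow>
     W ` bergman_space \<subseteq> bergman_space \<and>
     (\<forall>f\<in>bergman_space. \<forall>g\<in>bergman_space. W (\<lambda>z. f z + g z) = (\<lambda>z. W f z + W g z)) \<and>
     (\<forall>c. \<forall>f\<in>bergman_space. W (\<lambda>z. c * f z) = (\<lambda>z. c * W f z))"

definition bergman_adjoint ::
    "((complex \<Rightarrow> complex) \<Rightarrow> complex \<Rightarrow> complex) \<Rightarrow> (complex \<Rightarrow> complex) \<Rightarrow> complex \<Rightarrow> complex" where
  "bergman_adjoint W g =
     (THE h. h \<in> bergman_space \<and> (\<forall>f\<in>bergman_space. bergman_inner (W f) g = bergman_inner f h))"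

text \<open>A unitary operator is a surjective linear map preserving the inner product.\<close>

definition bergman_unitary :: "((complex \<Rightarrow> complex) \<Rightarrow> complex \<Rightarrow> complex) \<Rightarrow> bool" where
  "bergman_unitary W \<longleftrightarrow>
     bergman_linear W \<and> W ` bergman_space = bergman_space \<and>
     (\<forall>f\<in>bergman_space. \<forall>g\<in>bergman_space. bergman_inner (W f) (W g) = bergman_inner f g)"


subsection \<open>Finite Blaschke products and their local inverses\<close>

text \<open>The order of the product is the cardinality of the index type.\<close>

definition blaschke :: "('n::finite \<Rightarrow> complex) \<Rightarrow> complex \<Rightarrow> complex" where
  "blaschke a z = (\<Prod>j\<in>UNIV. (z - a j) / (1 - cnj (a j) * z))"

definition critical_points :: "(complex \<Rightarrow> complex) \<Rightarrow> complex set" where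
  "critical_points \<phi> = {z \<in> ball 0 1. deriv \<phi> z = 0}"

definition exceptional_set :: "(complex \<Rightarrow> complex) \<Rightarrow> complex set" where
  "exceptional_set \<phi> = ball 0 1 \<inter> \<phi> -` (\<phi> ` critical_points \<phi>)"

definition regular_set :: "(complex \<Rightarrow> complex) \<Rightarrow> complex set" where
  "regular_set \<phi> = ball 0 1 - exceptional_set \<phi>"

definition local_inverse ::
    "(complex \<Rightarrow> complex) \<Rightarrow> complex set \<Rightarrow> (complex \<Rightarrow> complex) \<Rightarrow> bool" where
  "local_inverse \<phi> V f \<longleftrightarrow>
     f holomorphic_on V \<and> f ` V \<subseteq> ball 0 1 \<and> (\<forall>z\<in>V. \<phi> (f z) = \<phi> z)"

definition complete_collection ::
    "(complex \<Rightarrow> complex) \<Rightarrow> complex set \<Rightarrow> 'i set \<Rightarrow> ('i \<Rightarrow> complex \<Rightarrow> complex) \<Rightarrow> bool" where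
  "complete_collection \<phi> V I f \<longleftrightarrow>
     finite I \<and> (\<forall>i\<in>I. local_inverse \<phi> V (f i)) \<and>
     (\<forall>z\<in>V. \<phi> -` {\<phi> z} \<inter> ball 0 1 \<subseteq> (\<lambda>i. f i z) ` I \<and>
             (\<forall>i\<in>I. \<forall>j\<in>I. i \<noteq> j \<longrightarrow> f i z \<noteq> f j z))"

text \<open>The witnessing collection of the invertible disc is indexed by natural numbers; on a disc any
  two complete collections agree up to relabelling, so disjointness does not depend on the choice.\<close>

definition small_invertible :: "(complex \<Rightarrow> complex) \<Rightarrow> complex set \<Rightarrow> bool" where
  "small_invertible \<phi> U \<longleftrightarrow>
     (\<exists>c r. 0 < r \<and> U = ball c r) \<and> U \<subseteq> regular_set \<phi> \<and>
     (\<exists>(m::nat) f. complete_collection \<phi> U {1..m} f \<and> disjoint_family_on (\<lambda>i. f i ` U) {1..m})"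

text \<open>The curve runs in the closed disc, passes through the exceptional points, ends on the unit
  circle, and cuts the regular set into a simply connected one.\<close>

definition cut_curve :: "(complex \<Rightarrow> complex) \<Rightarrow> (real \<Rightarrow> complex) \<Rightarrow> bool" where
  "cut_curve \<phi> \<gamma> \<longleftrightarrow>
     path \<gamma> \<and> path_image \<gamma> \<subseteq> cball 0 1 \<and> exceptional_set \<phi> \<subseteq> path_image \<gamma> \<and>
     pathfinish \<gamma> \<in> sphere 0 1 \<and> simply_connected (regular_set \<phi> - path_image \<gamma>)"

text \<open>An orientation, with \<open>e\<close> playing the role of the index 1.  The functions \<open>\<rho> j\<close> are the extended
  ones: the open set \<open>regular_set \<phi> - path_image \<gamma>\<close> is connected and contains the disc \<open>U\<close>, so a
  function holomorphic on it is the unique analytic extension of its restriction to \<open>U\<close>.\<close>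

definition orientation ::
    "(complex \<Rightarrow> complex) \<Rightarrow> complex set \<Rightarrow> (real \<Rightarrow> complex) \<Rightarrow> 'n::finite \<Rightarrow>
     ('n \<Rightarrow> complex \<Rightarrow> complex) \<Rightarrow> bool" where
  "orientation \<phi> U \<gamma> e \<rho> \<longleftrightarrow>
     complete_collection \<phi> U UNIV \<rho> \<and> (\<forall>z\<in>U. \<rho> e z = z) \<and>
     cut_curve \<phi> \<gamma> \<and> path_image \<gamma> \<inter> (\<Union>j. \<rho> j ` U) = {} \<and>
     (\<forall>j. \<rho> j holomorphic_on (regular_set \<phi> - path_image \<gamma>))"

definition orientation_perm ::
    "('n \<Rightarrow> complex \<Rightarrow> complex) \<Rightarrow> complex set \<Rightarrow> 'n \<Rightarrow> 'n \<Rightarrow> 'n" where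
  "orientation_perm \<rho> U i k = (THE m. \<forall>z\<in>U. \<rho> k (\<rho> i z) = \<rho> m z)"


subsection \<open>Matrices\<close>

definition unitary_matrix :: "complex^'n^'n \<Rightarrow> bool" where
  "unitary_matrix A \<longleftrightarrow>
     A ** (\<chi> i k. cnj (A $ k $ i)) = mat 1 \<and> (\<chi> i k. cnj (A $ k $ i)) ** A = mat 1"

text \<open>Row \<open>i\<close> lists the entries of \<open>r\<close> permuted by the inverse of the \<open>i\<close>-th permutation; in the row
  of the index 1 that permutation is the identity.\<close>

definition gamma_matrix ::
    "('n \<Rightarrow> complex \<Rightarrow> complex) \<Rightarrow> complex set \<Rightarrow> complex^'n \<Rightarrow> complex^'n^'n" where
  "gamma_matrix \<rho> U r = (\<chi> i k. r $ (inv (orientation_perm \<rho> U i) k))"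

end

theory Submission
  imports Defs "HOL-Complex_Analysis.Conformal_Mappings" "HOL-Real_Asymp.Real_Asymp"
begin

text \<open>Since \<open>W\<close> is isometric and commutes with multiplication by \<open>\<phi>\<close>, the function
  \<open>W f * cnj (W g) - f * cnj g\<close> is orthogonal to every polynomial in \<open>\<phi>\<close> and \<open>cnj \<phi>\<close>, so its push-forward
  under \<open>\<phi>\<close> vanishes.  Reading this off over one point, the vectors with entries
  \<open>\<rho>\<^sub>i'(\<alpha>) f(\<rho>\<^sub>i(\<alpha>))\<close> and \<open>\<rho>\<^sub>i'(\<alpha>) (W f)(\<rho>\<^sub>i(\<alpha>))\<close> are related by a unitary matrix depending
  only on \<open>\<alpha>\<close>.  Its first row is holomorphic in \<open>\<alpha>\<close> and has norm 1, hence is constant on \<open>U\<close>; by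
  analytic continuation the resulting formula for \<open>W f\<close> holds on the whole cut domain, and evaluating it
  at \<open>\<rho>\<^sub>i(\<alpha>)\<close> gives the remaining rows.  The reproducing kernel turns this into the statement about
  the adjoint.\<close>

subsection \<open>Integration over discs in the complex plane\<close>

text \<open>Kernel and adjoint are defined by description, so each has to be exhibited before it can
  be used; the integrals of monomials over discs serve to produce the kernel. The vanishing of the
  push-forward has to be exploited at a given value and not merely almost everywhere: over a regular
  value the density is a finite sum over the fibre, and shrinking test functions recover it exactly.
  The matrix obtained in this way is defined at each \<alpha> separately and has no visible
  regularity. Its first row becomes holomorphic because over a fibre \<open>W\<close> can be tested
  on polynomials whose coefficients are holomorphic in \<alpha>, and linearity pulls these
  coefficients out of \<open>W\<close>. Rigidity of a holomorphic row of constant length then leaves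
  only \<open>n\<close> numbers, which determine the whole matrix.\<close>

lemma lborel_complex_eq:
  "(lborel :: complex measure) = distr lborel borel (\<lambda>v::real^2. Complex (v$1) (v$2))"
proof (rule lborel_eqI)
  have cont: "continuous_on UNIV (\<lambda>v::real^2. Complex (v$1) (v$2))"
    by (simp add: Complex_eq continuous_intros)
  have meas [measurable]: "(\<lambda>v::real^2. Complex (v$1) (v$2)) \<in> borel_measurable borel"
    using cont by (rule borel_measurable_continuous_onI)
  fix l u :: complex assume le: "\<And>b. b \<in> Basis \<Longrightarrow> l \<bullet> b \<le> u \<bullet> b"
  have re: "Re l \<le> Re u" "Im l \<le> Im u"
    using le[of 1] le[of \<i>] by (auto simp: Basis_complex_def inner_complex_def)
  have "(\<lambda>v::real^2. Complex (v$1) (v$2)) -` box l u =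
      box (vector [Re l, Im l]) (vector [Re u, Im u])"
    by (simp add: box_def Basis_complex_def inner_complex_def Basis_vec_def UNIV_2 inner_axis
        vector_2 vimage_def) auto
  moreover have "emeasure lborel (box (vector [Re l, Im l]) (vector [Re u, Im u] :: real^2)) =
      ennreal ((Re u - Re l) * (Im u - Im l))"
  proof -
    have B: "(Basis :: (real^2) set) = {axis 1 1, axis 2 1}"
      by (auto simp: Basis_vec_def UNIV_2)
    have ne: "(axis 1 1 :: real^2) \<noteq> axis 2 1"
      by (simp add: axis_eq_axis)
    show ?thesis
      by (subst emeasure_lborel_box) (use re ne in \<open>auto simp: B inner_axis\<close>)
  qed
  ultimately show "emeasure (distr lborel borel (\<lambda>v::real^2. Complex (v$1) (v$2))) (box l u) =
      ennreal (\<Prod>b\<in>Basis. (u - l) \<bullet> b)"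
    by (subst emeasure_distr) (auto simp: Basis_complex_def inner_complex_def)
qed simp

text \<open>It suffices to compare boxes: the preimage of a box is its image under the inverse map,
  which is again orthogonal and so preserves Lebesgue measure. Passing through
  \<open>lebesgue\<close> is harmless because the preimage is Borel.\<close>

lemma distr_lborel_orthogonal:
  fixes f :: "real^'n::{finite,wellorder} \<Rightarrow> real^'n::_"
  assumes "orthogonal_transformation f"
  shows "distr lborel borel f = lborel"
proof (rule lborel_eqI[symmetric])
  have lin: "linear f" and bij: "bij f"
    using assms orthogonal_transformation_linear orthogonal_transformation_bij by auto
  have meas: "f \<in> borel_measurable borel"
    using lin by (intro borel_measurable_continuous_onI linear_continuous_on)
      (simp add: linear_conv_bounded_linear)
  have orth: "orthogonal_transformation (inv f)"
    using assms orthogonal_transformation_inv by blast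
  fix l u :: "real^'n::_" assume le: "\<And>b. b \<in> Basis \<Longrightarrow> l \<bullet> b \<le> u \<bullet> b"
  have pre: "f -` box l u = inv f ` box l u"
    using bij by (simp add: bij_vimage_eq_inv_image)
  have b: "box l u \<in> lmeasurable" by simp
  have lm: "f -` box l u \<in> lmeasurable" "measure lebesgue (f -` box l u) = measure lebesgue (box l u)"
    unfolding pre using measurable_orthogonal_image[OF orth b] measure_orthogonal_image[OF orth b]
    by auto
  have bor: "f -` box l u \<in> sets borel"
    using measurable_sets[OF meas, of "box l u"] by simp
  have "emeasure (distr lborel borel f) (box l u) = emeasure lborel (f -` box l u)"
    using meas by (subst emeasure_distr) auto
  also have "\<dots> = emeasure lebesgue (f -` box l u)"
    using bor by simp
  also have "\<dots> = ennreal (measure lebesgue (box l u))"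
    using lm by (metis emeasure_eq_measure2)
  also have "\<dots> = ennreal (\<Prod>b\<in>Basis. (u - l) \<bullet> b)"
    using le by (simp add: measure_lborel_box_eq inner_diff_left)
  finally show "emeasure (distr lborel borel f) (box l u) = ennreal (\<Prod>b\<in>Basis. (u - l) \<bullet> b)" .
qed simp

text \<open>Multiplication by a unimodular \<open>c\<close> is the orthogonal map \<open>R\<close>
  in real coordinates; the coordinate map \<open>T\<close> intertwines the two and carries
  \<open>lborel\<close> to \<open>lborel\<close>.\<close>

lemma distr_lborel_complex_rotation:
  fixes c :: complex
  assumes "norm c = 1"
  shows "distr lborel borel ((*) c) = (lborel :: complex measure)"
proof -
  define T where "T = (\<lambda>v::real^2. Complex (v$1) (v$2))"
  define R where "R = (\<lambda>v::real^2. vector [Re c * v$1 - Im c * v$2, Re c * v$2 + Im c * v$1] :: real^2)"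
  have cc: "Re c * Re c + Im c * Im c = 1"
    using assms by (metis cmod_power2 one_power2 power2_eq_square)
  have lin: "linear R"
    by (rule linearI) (auto simp: R_def vec_eq_iff forall_2 algebra_simps)
  have R: "orthogonal_transformation R"
    unfolding orthogonal_transformation_def
  proof (intro conjI allI lin)
    fix v w :: "real^2"
    have "R v \<bullet> R w = (Re c * Re c + Im c * Im c) * (v \<bullet> w)"
      by (simp add: R_def inner_vec_def sum_2 algebra_simps)
    then show "R v \<bullet> R w = v \<bullet> w" using cc by simp
  qed
  have T [measurable]: "T \<in> borel_measurable borel"
    unfolding T_def by (intro borel_measurable_continuous_onI) (simp add: Complex_eq continuous_intros)
  have Rm [measurable]: "R \<in> borel_measurable borel"
    using lin by (intro borel_measurable_continuous_onI linear_continuous_on)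
      (simp add: linear_conv_bounded_linear)
  have eq: "(*) c \<circ> T = T \<circ> R"
    by (auto simp: fun_eq_iff T_def R_def complex_eq_iff algebra_simps)
  have "distr lborel borel ((*) c) = distr (distr lborel borel T) borel ((*) c)"
    using lborel_complex_eq unfolding T_def by simp
  also have "\<dots> = distr lborel borel (T \<circ> R)"
    by (subst distr_distr) (simp_all add: eq)
  also have "\<dots> = distr (distr lborel borel R) borel T"
    by (subst distr_distr) simp_all
  also have "\<dots> = lborel"
    unfolding distr_lborel_orthogonal[OF R] using lborel_complex_eq unfolding T_def by simp
  finally show ?thesis .
qed

lemma measure_ball_complex:
  "r \<ge> 0 \<Longrightarrow> measure lborel (ball (c::complex) r) = pi * r\<^sup>2"
  by (simp add: content_ball eval_unit_ball_vol)

lemma emeasure_ball_complex: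
  "r \<ge> 0 \<Longrightarrow> emeasure lborel (ball (c::complex) r) = ennreal (pi * r\<^sup>2)"
  by (simp add: emeasure_ball eval_unit_ball_vol)

lemma set_integrable_continuous_ball:
  fixes f :: "complex \<Rightarrow> 'b::{banach,second_countable_topology}"
  assumes "continuous_on (cball 0 r) f"
  shows "set_integrable lborel (ball 0 r) f"
proof (rule set_integrable_subset)
  show "set_integrable lborel (cball 0 r) f"
    using assms by (intro borel_integrable_compact[folded set_integrable_def]) 
      (auto simp: set_integrable_def)
qed auto

text \<open>A rotation by \<open>c\<close> leaves the integral unchanged but multiplies the
  integrand by \<open>c ^ n * cnj c ^ m\<close>, so a single \<open>c\<close> for which this factor
  differs from 1 forces the integral to vanish.\<close>

lemma integral_monomial_ball_off:
  assumes "n \<noteq> m"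
  shows "(LINT z:ball 0 r|lborel. (z::complex) ^ n * cnj z ^ m) = 0"
proof -
  have aux: "(LINT z:ball 0 r|lborel. (z::complex) ^ n * cnj z ^ m) = 0" 
    if c: "norm c = 1" "c ^ n * cnj c ^ m \<noteq> 1" for c :: complex
  proof -
    let ?I = "LINT z:ball 0 r|lborel. (z::complex) ^ n * cnj z ^ m"
    have [measurable]: "(\<lambda>z. indicator (ball 0 r) z *\<^sub>R (z ^ n * cnj z ^ m) :: complex) \<in> borel_measurable borel"
      by (intro borel_measurable_scaleR borel_measurable_indicator borel_measurable_continuous_onI
          continuous_intros) auto
    have "?I = (LINT z|distr lborel borel ((*) c). indicator (ball 0 r) z *\<^sub>R (z ^ n * cnj z ^ m))"
      unfolding distr_lborel_complex_rotation[OF c(1)] set_lebesgue_integral_def ..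
    also have "\<dots> = (LINT z|lborel. indicator (ball 0 r) (c * z) *\<^sub>R ((c * z) ^ n * cnj (c * z) ^ m))"
      by (subst integral_distr) simp_all
    also have "\<dots> = (LINT z|lborel. (c ^ n * cnj c ^ m) * (indicator (ball 0 r) z *\<^sub>R (z ^ n * cnj z ^ m)))"
      by (rule Bochner_Integration.integral_cong)
        (auto simp: indicator_def norm_mult c power_mult_distrib)
    also have "\<dots> = (c ^ n * cnj c ^ m) * ?I"
      unfolding set_lebesgue_integral_def by (rule Bochner_Integration.integral_mult_right_zero)
    finally show ?thesis using c(2) by (simp only: mult_cancel_right1) blast
  qed
  \<comment> \<open>This angle makes \<open>(n - m) * t = pi\<close>, so the factor belonging to
    \<open>cis t\<close> is -1.\<close>
  define t where "t = pi / (real n - real m)"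
  have "cis t ^ n * cnj (cis t) ^ m = cis (real n * t - real m * t)"
    using Complex.DeMoivre[of t n] Complex.DeMoivre[of "- t" m] cis_mult[of "real n * t" "- (real m * t)"]
    by (simp add: cis_cnj)
  also have "real n * t - real m * t = (real n - real m) * t" by (simp add: left_diff_distrib)
  also have "\<dots> = pi" using assms by (simp add: t_def)
  finally show ?thesis by (intro aux[of "cis t"]) (auto simp: complex_eq_iff)
qed

text \<open>Under area measure on the disc, \<open>|z|^2\<close> is distributed as \<open>pi\<close>
  times Lebesgue measure on the interval from 0 to \<open>r^2\<close>, because the part of the disc
  where \<open>|z|^2 > x\<close> has area \<open>pi * (r^2 - x)\<close>. The integral becomes that
  of \<open>pi * x ^ n\<close> over this interval.\<close>

lemma integral_norm_power_ball:
  assumes "r \<ge> 0"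
  shows "(LINT z:ball 0 r|lborel. norm (z::complex) ^ (2 * n)) = pi * r ^ (2 * n + 2) / (real n + 1)"
proof -
  define M where "M = distr (density lborel (\<lambda>z. ennreal (indicator (ball (0::complex) r) z))) borel (\<lambda>z. (norm z)\<^sup>2)"
  define N where "N = density lborel (\<lambda>x::real. ennreal (pi * indicator {0..r\<^sup>2} x))"
  have M: "emeasure M {x<..} = emeasure lborel (ball 0 r \<inter> {z::complex. x < (norm z)\<^sup>2})" for x
  proof -
    have "emeasure M {x<..} = emeasure (density lborel (indicator (ball (0::complex) r))) {z. x < (norm z)\<^sup>2}"
      unfolding M_def ennreal_indicator by (subst emeasure_distr) (auto simp: vimage_def)
    also have "\<dots> = (\<integral>\<^sup>+ z. indicator (ball 0 r \<inter> {z::complex. x < (norm z)\<^sup>2}) z \<partial>lborel)"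
      by (subst emeasure_density)
        (auto simp: indicator_inter_arith simp del: nn_integral_indicator
          intro!: borel_measurable_indicator nn_integral_cong)
    also have "\<dots> = emeasure lborel (ball 0 r \<inter> {z::complex. x < (norm z)\<^sup>2})"
      by (subst nn_integral_indicator) auto
    finally show ?thesis .
  qed
  have N: "emeasure N {x<..} = ennreal pi * emeasure lborel ({0..r\<^sup>2} \<inter> {x<..})" for x
    unfolding N_def
    by (subst emeasure_density)
      (auto simp: nn_integral_cmult_indicator[symmetric] intro!: nn_integral_cong split: split_indicator)
  have eq: "emeasure M {x<..} = emeasure N {x<..}" for x
  proof (cases "x < 0")
    case True
    have "ball 0 r \<inter> {z::complex. x < (norm z)\<^sup>2} = ball 0 r" "{0..r\<^sup>2} \<inter> {x<..} = {0..r\<^sup>2}"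
      using True by (auto intro: less_le_trans)
    then show ?thesis
      unfolding M N using assms by (simp add: emeasure_ball_complex ennreal_mult)
  next
    case False
    show ?thesis
    proof (cases "x < r\<^sup>2")
      case True
      have lt: "sqrt x < r" using True False assms by (simp add: real_less_lsqrt)
      have sub: "cball 0 (sqrt x) \<subseteq> ball (0::complex) r" using lt by auto
      have fin: "emeasure lborel (cball (0::complex) (sqrt x)) \<noteq> \<infinity>"
        using emeasure_lborel_cball_finite[of "0::complex" "sqrt x"] by (simp add: less_top)
      have ball: "ball 0 r \<inter> {z::complex. x < (norm z)\<^sup>2} = ball 0 r - cball 0 (sqrt x)"
        using False assms by (auto simp: real_le_lsqrt not_le real_less_rsqrt sqrt_le_D)
         (metis not_le real_sqrt_le_iff real_sqrt_unique norm_ge_zero)+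
      have "emeasure M {x<..} = emeasure lborel (ball (0::complex) r) - emeasure lborel (cball (0::complex) (sqrt x))"
        unfolding M ball by (rule emeasure_Diff[OF fin _ _ sub]) auto
      also have "\<dots> = ennreal (pi * (r\<^sup>2 - x))"
        using False True assms by (simp add: emeasure_ball_complex emeasure_cball eval_unit_ball_vol ennreal_minus algebra_simps)
      also have "\<dots> = emeasure N {x<..}"
      proof -
        have "{0..r\<^sup>2} \<inter> {x<..} = {x<..r\<^sup>2}" using False by auto
        then show ?thesis unfolding N using True by (simp add: ennreal_mult)
      qed
      finally show ?thesis .
    next
      case F: False
      have "ball 0 r \<inter> {z::complex. x < (norm z)\<^sup>2} = {}"
      proof -
        have "(norm z)\<^sup>2 \<le> x" if "norm z < r" for z :: complex
          using F power_mono[of "norm z" r 2] that by simp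
        then show ?thesis by (auto simp flip: not_le)
      qed
      moreover have "{0..r\<^sup>2} \<inter> {x<..} = {}" using F by auto
      ultimately show ?thesis unfolding M N by simp
    qed
  qed
  have MN: "M = N"
  proof (rule measure_eqI_lessThan)
    show "emeasure M {x<..} < \<infinity>" for x
      unfolding M by (rule le_less_trans[OF emeasure_mono[of _ "ball 0 r"]])
        (use emeasure_lborel_ball_finite[of "0::complex" r] in auto)
    show "sets M = sets borel" "sets N = sets borel" by (simp_all add: M_def N_def)
  qed (rule eq)
  have "(LINT x|M. x ^ n) =
      (LINT z|density lborel (\<lambda>z. ennreal (indicator (ball (0::complex) r) z)). ((norm z)\<^sup>2) ^ n)"
    unfolding M_def by (rule integral_distr) auto
  also have "\<dots> = (LINT z|lborel. indicator (ball (0::complex) r) z *\<^sub>R ((norm z)\<^sup>2) ^ n)"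
    by (rule integral_density) (auto intro!: borel_measurable_indicator)
  finally have "(LINT z:ball 0 r|lborel. norm (z::complex) ^ (2 * n)) = (LINT x|M. x ^ n)"
    by (simp add: set_lebesgue_integral_def power_mult)
  also have "\<dots> = (LINT x|lborel. pi * (indicator {0..r\<^sup>2} x * x ^ n))"
    unfolding MN N_def by (subst integral_density) (auto simp: mult_ac)
  also have "\<dots> = pi * (LINT x|lborel. indicator {0..r\<^sup>2} x * x ^ n)" by simp
  also have "(LINT x|lborel. indicator {0..r\<^sup>2} x * x ^ n) = (r\<^sup>2) ^ Suc n / Suc n"
    using integral_power[of 0 "r\<^sup>2" n] by (simp add: mult.commute)
  also have "(r\<^sup>2) ^ Suc n = r ^ (2 * n + 2)"
    using power_mult[of r 2 "Suc n"] by simp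
  finally show ?thesis by (simp add: add.commute)
qed

lemma integral_monomial_ball:
  assumes "r \<ge> 0"
  shows "(LINT z:ball 0 r|lborel. (z::complex) ^ n * cnj z ^ m) =
    (if n = m then of_real (pi * r ^ (2 * n + 2) / (real n + 1)) else 0)"
proof -
  have "(LINT z:ball 0 r|lborel. (z::complex) ^ n * cnj z ^ n) =
        (LINT z:ball 0 r|lborel. complex_of_real (cmod z ^ (2 * n)))"
    by (simp add: power_mult_distrib[symmetric] complex_norm_square[symmetric] power_mult)
  also have "\<dots> = complex_of_real (LINT z:ball 0 r|lborel. norm (z::complex) ^ (2 * n))"
    by (rule set_integral_complex_of_real)
  finally show ?thesis
    using integral_monomial_ball_off[of n m r] integral_norm_power_ball[OF assms, of n] by auto
qed


subsection \<open>The reproducing kernel of the Bergman space\<close>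

text \<open>An M-test under the integral sign: on a disc of finite area the L1 norms of the terms
  are at most that area times \<open>B n\<close>.\<close>

lemma set_integral_sums_ball:
  fixes f :: "nat \<Rightarrow> complex \<Rightarrow> complex"
  assumes cont: "\<And>n. continuous_on (cball 0 r) (f n)"
    and bound: "\<And>n z. z \<in> ball 0 r \<Longrightarrow> norm (f n z) \<le> B n" and B: "summable B"
    and sums: "\<And>z. z \<in> ball 0 r \<Longrightarrow> (\<lambda>n. f n z) sums g z" and r: "r \<ge> 0"
  shows "(\<lambda>n. LINT z:ball 0 r|lborel. f n z) sums (LINT z:ball 0 r|lborel. g z)"
proof -
  define F where "F = (\<lambda>n z. indicator (ball 0 r) z *\<^sub>R f n z)"
  have int: "integrable lborel (F n)" for n
    using set_integrable_continuous_ball[OF cont] by (simp add: F_def set_integrable_def)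
  have Fb: "norm (F n z) \<le> indicator (ball 0 r) z * B n" for n z
    using bound by (auto simp: F_def indicator_def)
  have summ: "summable (\<lambda>n. norm (F n z))" for z
  proof (rule summable_comparison_test')
    show "summable (\<lambda>n. indicator (ball 0 r) z * B n)" using B by (rule summable_mult)
  qed (use Fb in simp)
  have intB: "integrable lborel (\<lambda>z. indicator (ball (0::complex) r) z * B n)" for n
    by (auto intro!: integrable_mult_left integrable_real_indicator simp: emeasure_ball_complex r)
  have "(LINT z|lborel. norm (F n z)) \<le> measure lborel (ball (0::complex) r) * B n" for n
  proof -
    have "(LINT z|lborel. norm (F n z)) \<le> (LINT z|lborel. indicator (ball (0::complex) r) z * B n)"
      by (rule integral_mono) (use int intB Fb in \<open>auto intro: integrable_norm\<close>)
    also have "\<dots> = measure lborel (ball (0::complex) r) * B n" by simp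
    finally show ?thesis .
  qed
  then have "summable (\<lambda>n. LINT z|lborel. norm (F n z))"
    by (intro summable_comparison_test'[OF summable_mult[OF B]]) auto
  then have "(\<lambda>n. integral\<^sup>L lborel (F n)) sums (LINT z|lborel. (\<Sum>n. F n z))"
    by (intro sums_integral int) (use summ in auto)
  moreover have "(\<Sum>n. F n z) = indicator (ball 0 r) z *\<^sub>R g z" for z
    using sums[of z] by (auto simp: F_def indicator_def sums_iff)
  ultimately show ?thesis
    unfolding set_lebesgue_integral_def F_def by simp
qed

text \<open>Orthogonality of the monomials leaves only the Taylor term of degree
  \<open>m\<close>.\<close>

lemma set_integral_holomorphic_times_cnj_power:
  fixes f :: "complex \<Rightarrow> complex"
  assumes f: "f holomorphic_on ball 0 1" and r: "0 < r" "r < 1"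
  shows "(LINT z:ball 0 r|lborel. f z * cnj z ^ m) =
    (deriv ^^ m) f 0 / fact m * of_real (pi * r ^ (2 * m + 2) / (real m + 1))"
proof -
  define a where "a = (\<lambda>n. (deriv ^^ n) f 0 / fact n)"
  have sums: "(\<lambda>n. a n * z ^ n) sums f z" if "z \<in> ball 0 1" for z
    using holomorphic_power_series[OF f that] by (simp add: a_def)
  \<comment> \<open>Convergence of the Taylor series at a point \<open>s\<close> beyond
    \<open>r\<close> gives absolute convergence at \<open>r\<close>, hence the summable
    majorant.\<close>
  obtain s where s: "r < s" "s < 1" using r dense by blast
  have "summable (\<lambda>n. a n * of_real s ^ n)"
    using sums[of "of_real s"] s r by (auto simp: sums_iff)
  then have "summable (\<lambda>n. of_real (norm (a n)) * complex_of_real r ^ n)"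
    by (rule power_series_conv_imp_absconv_weak) (use s r in auto)
  then have "summable (\<lambda>n. complex_of_real (norm (a n) * r ^ n))" by simp
  then have B: "summable (\<lambda>n. norm (a n) * r ^ n)" by (simp only: summable_of_real_iff)
  have "(\<lambda>n. LINT z:ball 0 r|lborel. a n * z ^ n * cnj z ^ m) sums (LINT z:ball 0 r|lborel. f z * cnj z ^ m)"
  proof (rule set_integral_sums_ball)
    show "summable (\<lambda>n. norm (a n) * r ^ n * 1)" using B by simp
    show "norm (a n * z ^ n * cnj z ^ m) \<le> norm (a n) * r ^ n * 1" if "z \<in> ball 0 r" for n z
      unfolding norm_mult norm_power complex_mod_cnj
      using that r by (intro mult_mono power_mono power_le_one) auto
    show "(\<lambda>n. a n * z ^ n * cnj z ^ m) sums (f z * cnj z ^ m)" if "z \<in> ball 0 r" for z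
      using that r by (intro sums_mult2 sums) auto
  qed (use r in \<open>auto intro!: continuous_intros\<close>)
  moreover have "(LINT z:ball 0 r|lborel. a n * z ^ n * cnj z ^ m) =
      (if n = m then a n * of_real (pi * r ^ (2 * n + 2) / (real n + 1)) else 0)" for n
  proof -
    have "(LINT z:ball 0 r|lborel. a n * z ^ n * cnj z ^ m) = a n * (LINT z:ball 0 r|lborel. z ^ n * cnj z ^ m)"
      by (simp only: mult.assoc set_integral_mult_right)
    then show ?thesis using integral_monomial_ball[of r n m] r by auto
  qed
  ultimately have "(\<lambda>n. if n = m then a n * of_real (pi * r ^ (2 * n + 2) / (real n + 1)) else 0)
      sums (LINT z:ball 0 r|lborel. f z * cnj z ^ m)" by simp
  then show ?thesis
    using sums_single[of m "\<lambda>n. a n * of_real (pi * r ^ (2 * n + 2) / (real n + 1))"]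
    by (simp add: sums_unique2 a_def)
qed

text \<open>The conjugated kernel expands as the sum of
  \<open>(m + 1) * (\<alpha> * cnj z) ^ m\<close>. The factor \<open>m + 1\<close> cancels the
  denominator of the moment and the powers of \<open>r\<close> regroup as
  \<open>r^2 * (r^2) ^ m\<close>, so that the Taylor series of \<open>f\<close> at
  \<open>r^2 * \<alpha>\<close> appears. Taking \<open>r < 1\<close> keeps \<open>f\<close> bounded
  on the disc of integration.\<close>

lemma set_integral_kernel_ball:
  fixes f :: "complex \<Rightarrow> complex"
  assumes f: "f holomorphic_on ball 0 1" and r: "0 < r" "r < 1" and \<alpha>: "\<alpha> \<in> ball 0 1"
  shows "(LINT z:ball 0 r|lborel. f z * cnj (1 / (1 - cnj \<alpha> * z)\<^sup>2)) = pi * of_real (r\<^sup>2) * f (of_real (r\<^sup>2) * \<alpha>)"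
proof -
  have cont: "continuous_on (cball 0 r) f"
    using holomorphic_on_imp_continuous_on[OF f] by (rule continuous_on_subset) (use r in auto)
  then have "bounded (f ` cball 0 r)"
    by (intro compact_imp_bounded compact_continuous_image) auto
  then obtain K where K: "\<And>z. z \<in> cball 0 r \<Longrightarrow> norm (f z) \<le> K"
    unfolding bounded_iff by (metis imageI)
  have K0: "K \<ge> 0" using K[of 0] r norm_ge_zero order_trans by (metis centre_in_cball less_imp_le)
  have "(\<lambda>m. LINT z:ball 0 r|lborel. f z * (of_nat (Suc m) * (\<alpha> * cnj z) ^ m)) sums
      (LINT z:ball 0 r|lborel. f z * cnj (1 / (1 - cnj \<alpha> * z)\<^sup>2))"
  proof (rule set_integral_sums_ball)
    show "summable (\<lambda>m. K * (of_nat (Suc m) * norm \<alpha> ^ m))"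
      using geometric_deriv_sums[of "norm \<alpha>"] \<alpha> by (intro summable_mult) (auto simp: sums_iff)
    show "norm (f z * (of_nat (Suc m) * (\<alpha> * cnj z) ^ m)) \<le> K * (of_nat (Suc m) * norm \<alpha> ^ m)"
      if "z \<in> ball 0 r" for m z
    proof -
      have "norm (\<alpha> * cnj z) \<le> norm \<alpha>"
        using that r by (simp add: norm_mult mult_left_le)
      then have "norm (of_nat (Suc m) * (\<alpha> * cnj z) ^ m) \<le> real (Suc m) * norm \<alpha> ^ m"
        unfolding norm_mult[of "of_nat _"] norm_of_nat norm_power
        by (intro mult_left_mono power_mono) auto
      then show ?thesis
        unfolding norm_mult[of "f z"] using K[of z] that K0 by (intro mult_mono) auto
    qed
    show "(\<lambda>m. f z * (of_nat (Suc m) * (\<alpha> * cnj z) ^ m)) sums (f z * cnj (1 / (1 - cnj \<alpha> * z)\<^sup>2))"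
      if "z \<in> ball 0 r" for z
    proof -
      have "norm \<alpha> * norm z < 1 * 1"
        using that r \<alpha> by (intro mult_strict_mono') auto
      then have "norm (\<alpha> * cnj z) < 1" by (simp add: norm_mult)
      from sums_mult[OF geometric_deriv_sums[OF this], of "f z"] show ?thesis by simp
    qed
    show "continuous_on (cball 0 r) (\<lambda>z. f z * (of_nat (Suc m) * (\<alpha> * cnj z) ^ m))" for m
      by (intro continuous_intros cont)
  qed (use r in auto)
  moreover have "(LINT z:ball 0 r|lborel. f z * (of_nat (Suc m) * (\<alpha> * cnj z) ^ m)) =
      pi * of_real (r\<^sup>2) * ((deriv ^^ m) f 0 / fact m * (of_real (r\<^sup>2) * \<alpha>) ^ m)" for m
  proof -
    have "(LINT z:ball 0 r|lborel. f z * (of_nat (Suc m) * (\<alpha> * cnj z) ^ m)) =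
        (LINT z:ball 0 r|lborel. (of_nat (Suc m) * \<alpha> ^ m) * (f z * cnj z ^ m))"
      by (simp add: power_mult_distrib mult_ac)
    also have "\<dots> = (of_nat (Suc m) * \<alpha> ^ m) * (LINT z:ball 0 r|lborel. f z * cnj z ^ m)"
      by (rule set_integral_mult_right)
    also have "\<dots> = (of_nat (Suc m) * \<alpha> ^ m) * ((deriv ^^ m) f 0 / fact m * of_real (pi * r ^ (2 * m + 2) / real (Suc m)))"
      by (subst set_integral_holomorphic_times_cnj_power[OF f r]) (simp add: add.commute)
    also have "\<dots> = pi * of_real (r\<^sup>2) * ((deriv ^^ m) f 0 / fact m * (of_real (r\<^sup>2) * \<alpha>) ^ m)"
      by (simp add: power_mult_distrib power_mult power_add power2_eq_square del: of_nat_Suc)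
    finally show ?thesis .
  qed
  ultimately have "(\<lambda>m. pi * of_real (r\<^sup>2) * ((deriv ^^ m) f 0 / fact m * (of_real (r\<^sup>2) * \<alpha>) ^ m)) sums
      (LINT z:ball 0 r|lborel. f z * cnj (1 / (1 - cnj \<alpha> * z)\<^sup>2))" by simp
  moreover have "(\<lambda>m. pi * of_real (r\<^sup>2) * ((deriv ^^ m) f 0 / fact m * (of_real (r\<^sup>2) * \<alpha>) ^ m)) sums
      (pi * of_real (r\<^sup>2) * f (of_real (r\<^sup>2) * \<alpha>))"
  proof (intro sums_mult)
    have "r\<^sup>2 * norm \<alpha> < 1 * 1"
      using r \<alpha> power_strict_mono[of r 1 2] by (intro mult_strict_mono') auto
    then have "of_real (r\<^sup>2) * \<alpha> \<in> ball 0 1" by (simp add: norm_mult norm_power)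
    from holomorphic_power_series[OF f this]
    show "(\<lambda>m. (deriv ^^ m) f 0 / fact m * (of_real (r\<^sup>2) * \<alpha>) ^ m) sums f (of_real (r\<^sup>2) * \<alpha>)" by simp
  qed
  ultimately show ?thesis by (rule sums_unique2)
qed

section \<open>Normalized area measure and the inner product space of Bergman functions\<close>

lemma disc_area_eq:
  "disc_area = density lborel (\<lambda>z. ennreal (indicator (ball 0 1) z / pi))"
  unfolding disc_area_def uniform_measure_def
proof (rule density_cong)
  show "AE z in lborel. indicator (ball 0 1) z / emeasure lborel (ball (0::complex) 1) =
      ennreal (indicator (ball 0 1) z / pi)"
    by (intro AE_I2) (simp add: emeasure_ball_complex indicator_def ennreal_divide_numeral divide_ennreal flip: ennreal_1)
qed (auto intro!: borel_measurable_divide borel_measurable_divide_ennreal borel_measurable_indicator measurable_compose[OF _ measurable_ennreal])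

lemma integral_disc_area:
  fixes f :: "complex \<Rightarrow> 'b::{banach,second_countable_topology}"
  assumes "f \<in> borel_measurable borel"
  shows "integral\<^sup>L disc_area f = (1 / pi) *\<^sub>R (LINT z:ball 0 1|lborel. f z)"
proof -
  have "integral\<^sup>L disc_area f = (LINT z|lborel. (indicator (ball 0 1) z / pi) *\<^sub>R f z)"
    unfolding disc_area_eq
    by (rule integral_density) (use assms in \<open>auto intro!: borel_measurable_divide borel_measurable_indicator\<close>)
  also have "\<dots> = (LINT z|lborel. (1 / pi) *\<^sub>R (indicator (ball 0 1) z *\<^sub>R f z))"
    by (simp add: divide_inverse mult.commute)
  finally show ?thesis by (simp only: set_lebesgue_integral_def integral_scaleR_right)
qed

lemma integrable_disc_area_iff:
  fixes f :: "complex \<Rightarrow> 'b::{banach,second_countable_topology}"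
  assumes "f \<in> borel_measurable borel"
  shows "integrable disc_area f \<longleftrightarrow> set_integrable lborel (ball 0 1) f"
proof -
  have "integrable disc_area f \<longleftrightarrow> integrable lborel (\<lambda>z. (indicator (ball 0 1) z / pi) *\<^sub>R f z)"
    unfolding disc_area_eq
    by (rule integrable_density) (use assms in \<open>auto intro!: borel_measurable_divide borel_measurable_indicator\<close>)
  also have "(\<lambda>z. (indicator (ball 0 1) z / pi) *\<^sub>R f z) = (\<lambda>z. (1 / pi) *\<^sub>R (indicator (ball 0 1) z *\<^sub>R f z))"
    by (simp add: divide_inverse mult.commute)
  also have "integrable lborel \<dots> \<longleftrightarrow> set_integrable lborel (ball 0 1) f"
    unfolding set_integrable_def
    using integrable_scaleR_right[of "1 / pi" lborel "\<lambda>z. indicator (ball 0 1) z *\<^sub>R f z"]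
      integrable_scaleR_right[of pi lborel "\<lambda>z. (1 / pi) *\<^sub>R (indicator (ball 0 1) z *\<^sub>R f z)"]
    by auto
  finally show ?thesis .
qed

lemma finite_measure_disc_area: "finite_measure disc_area"
  by (rule finite_measureI)
    (simp add: disc_area_def emeasure_ball_complex ennreal_divide_eq_top_iff)

lemma bergman_space_holomorphic: "f \<in> bergman_space \<Longrightarrow> f holomorphic_on ball 0 1"
  and bergman_space_integrable: "f \<in> bergman_space \<Longrightarrow> integrable disc_area (\<lambda>z. (norm (f z))\<^sup>2)"
  and bergman_space_outside: "f \<in> bergman_space \<Longrightarrow> z \<notin> ball 0 1 \<Longrightarrow> f z = 0"
  by (simp_all add: bergman_space_def)

lemma borel_measurable_holomorphic_disc:
  assumes "f holomorphic_on ball 0 1" "\<And>z. z \<notin> ball 0 1 \<Longrightarrow> f z = 0"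
  shows "f \<in> borel_measurable borel"
proof -
  have "(\<lambda>z. indicator (ball 0 1) z *\<^sub>R f z) \<in> borel_measurable borel"
    by (rule borel_measurable_continuous_on_indicator)
      (use assms holomorphic_on_imp_continuous_on in auto)
  also have "(\<lambda>z. indicator (ball 0 1) z *\<^sub>R f z) = f"
    using assms(2) by (auto simp: indicator_def fun_eq_iff)
  finally show ?thesis .
qed

lemma borel_measurable_bergman [measurable_dest]:
  "f \<in> bergman_space \<Longrightarrow> f \<in> borel_measurable borel"
  by (intro borel_measurable_holomorphic_disc bergman_space_holomorphic bergman_space_outside)

lemma sets_disc_area [measurable_cong, simp]: "sets disc_area = sets borel"
  by (simp add: disc_area_def)

lemma space_disc_area [simp]: "space disc_area = UNIV"
  by (simp add: disc_area_def)

lemma borel_measurable_disc_area: "borel_measurable disc_area = borel_measurable borel"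
  by (rule measurable_cong_sets) simp_all

lemma bergman_inner_integrable:
  assumes f: "f \<in> bergman_space" and g: "g \<in> bergman_space"
  shows "integrable disc_area (\<lambda>z. f z * cnj (g z))"
proof (rule Bochner_Integration.integrable_bound)
  show "integrable disc_area (\<lambda>z. (norm (f z))\<^sup>2 + (norm (g z))\<^sup>2)"
    using f g by (intro Bochner_Integration.integrable_add bergman_space_integrable)
  show "(\<lambda>z. f z * cnj (g z)) \<in> borel_measurable disc_area"
  proof -
    have "(\<lambda>z. cnj (g z)) \<in> borel_measurable borel"
      by (rule borel_measurable_continuous_on[OF _ borel_measurable_bergman[OF g]]) (intro continuous_intros)
    from borel_measurable_times[OF borel_measurable_bergman[OF f] this] show ?thesis
      unfolding borel_measurable_disc_area .
  qed
  have "x * y \<le> x\<^sup>2 + y\<^sup>2" if "x \<ge> 0" "y \<ge> 0" for x y :: real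
    using sum_squares_bound[of x y] mult_nonneg_nonneg[OF that] by linarith
  then show "AE z in disc_area. norm (f z * cnj (g z)) \<le> norm ((norm (f z))\<^sup>2 + (norm (g z))\<^sup>2)"
    by (intro AE_I2) (simp add: norm_mult)
qed

lemma bergman_space_add:
  assumes f: "f \<in> bergman_space" and g: "g \<in> bergman_space"
  shows "(\<lambda>z. f z + g z) \<in> bergman_space"
proof -
  have m: "(\<lambda>z. f z + g z) \<in> borel_measurable borel"
    by (intro borel_measurable_add borel_measurable_bergman f g)
  have "integrable disc_area (\<lambda>z. (norm (f z + g z))\<^sup>2)"
  proof (rule Bochner_Integration.integrable_bound)
    show "integrable disc_area (\<lambda>z. 2 * ((norm (f z))\<^sup>2 + (norm (g z))\<^sup>2))"
      using f g by (intro integrable_mult_right Bochner_Integration.integrable_add bergman_space_integrable)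
    show "(\<lambda>z. (norm (f z + g z))\<^sup>2) \<in> borel_measurable disc_area"
      unfolding borel_measurable_disc_area by (intro borel_measurable_power measurable_compose[OF m borel_measurable_norm])
    have "(norm (f z + g z))\<^sup>2 \<le> 2 * ((norm (f z))\<^sup>2 + (norm (g z))\<^sup>2)" for z
    proof -
      have "(norm (f z + g z))\<^sup>2 \<le> (norm (f z) + norm (g z))\<^sup>2"
        by (intro power_mono norm_triangle_ineq) auto
      also have "\<dots> \<le> 2 * ((norm (f z))\<^sup>2 + (norm (g z))\<^sup>2)"
        using sum_squares_bound[of "norm (f z)" "norm (g z)"] by (simp add: power2_sum)
      finally show ?thesis .
    qed
    then show "AE z in disc_area. norm ((norm (f z + g z))\<^sup>2) \<le> norm (2 * ((norm (f z))\<^sup>2 + (norm (g z))\<^sup>2))"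
      by (intro AE_I2) simp
  qed
  then show ?thesis
    using f g by (auto simp: bergman_space_def intro: holomorphic_intros)
qed

lemma bergman_space_mult:
  assumes f: "f \<in> bergman_space" and p: "p holomorphic_on ball 0 1"
    and b: "\<And>z. z \<in> ball 0 1 \<Longrightarrow> norm (p z) \<le> B"
  shows "(\<lambda>z. p z * f z) \<in> bergman_space"
proof -
  have hol: "(\<lambda>z. p z * f z) holomorphic_on ball 0 1"
    using bergman_space_holomorphic[OF f] p by (intro holomorphic_intros)
  have "integrable disc_area (\<lambda>z. (norm (p z * f z))\<^sup>2)"
  proof (rule Bochner_Integration.integrable_bound)
    show "integrable disc_area (\<lambda>z. B\<^sup>2 * (norm (f z))\<^sup>2)"
      using f by (intro integrable_mult_right bergman_space_integrable)
    have "(\<lambda>z. p z * f z) \<in> borel_measurable borel"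
      using hol by (rule borel_measurable_holomorphic_disc) (simp add: bergman_space_outside[OF f])
    then show "(\<lambda>z. (norm (p z * f z))\<^sup>2) \<in> borel_measurable disc_area"
      unfolding borel_measurable_disc_area by (intro borel_measurable_power measurable_compose[OF _ borel_measurable_norm])
    have "(norm (p z * f z))\<^sup>2 \<le> B\<^sup>2 * (norm (f z))\<^sup>2" for z
    proof (cases "z \<in> ball 0 1")
      case True
      then show ?thesis
        unfolding norm_mult power_mult_distrib by (intro mult_right_mono power_mono b) auto
    qed (simp add: bergman_space_outside[OF f])
    then show "AE z in disc_area. norm ((norm (p z * f z))\<^sup>2) \<le> norm (B\<^sup>2 * (norm (f z))\<^sup>2)"
      by (intro AE_I2) (simp add: abs_mult)
  qed
  with hol show ?thesis by (simp add: bergman_space_def bergman_space_outside[OF f])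
qed

lemma bergman_space_cmult: "f \<in> bergman_space \<Longrightarrow> (\<lambda>z. c * f z) \<in> bergman_space"
  by (rule bergman_space_mult[where B = "norm c"]) auto

lemma bergman_space_diff:
  "f \<in> bergman_space \<Longrightarrow> g \<in> bergman_space \<Longrightarrow> (\<lambda>z. f z - g z) \<in> bergman_space"
  using bergman_space_add[of f "\<lambda>z. (-1) * g z"] bergman_space_cmult[of g "-1"] by simp

lemma bergman_space_zero: "(\<lambda>z. 0) \<in> bergman_space"
  by (simp add: bergman_space_def)

lemma bergman_space_sum:
  "(\<And>i. i \<in> I \<Longrightarrow> f i \<in> bergman_space) \<Longrightarrow> (\<lambda>z. \<Sum>i\<in>I. f i z) \<in> bergman_space"
  by (induction I rule: infinite_finite_induct) (auto intro: bergman_space_zero bergman_space_add)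

lemma bergman_space_indicator: "indicator (ball 0 1) \<in> bergman_space"
proof -
  have "indicator (ball 0 1) holomorphic_on ball (0::complex) 1"
    by (rule holomorphic_transform[of "\<lambda>_. 1"]) auto
  moreover have "integrable disc_area (\<lambda>z. (norm (indicator (ball 0 1) z :: complex))\<^sup>2)"
    by (rule finite_measure.integrable_const_bound[OF finite_measure_disc_area, where B = 1])
      (auto simp: indicator_def intro!: measurable_If)
  ultimately show ?thesis by (simp add: bergman_space_def)
qed

lemma bergman_space_bounded:
  assumes "p holomorphic_on ball 0 1" "\<And>z. z \<in> ball 0 1 \<Longrightarrow> norm (p z) \<le> B"
  shows "(\<lambda>z. p z * indicator (ball 0 1) z) \<in> bergman_space"
  by (rule bergman_space_mult[OF bergman_space_indicator assms])

lemma bergman_inner_diff_right: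
  assumes "f \<in> bergman_space" "g \<in> bergman_space" "h \<in> bergman_space"
  shows "bergman_inner f (\<lambda>z. g z - h z) = bergman_inner f g - bergman_inner f h"
  unfolding bergman_inner_def
  using Bochner_Integration.integral_diff[OF bergman_inner_integrable[OF assms(1,2)] bergman_inner_integrable[OF assms(1,3)]]
  by (simp add: right_diff_distrib)

lemma bergman_inner_sum_right:
  assumes "f \<in> bergman_space" "\<And>i. i \<in> I \<Longrightarrow> g i \<in> bergman_space"
  shows "bergman_inner f (\<lambda>z. \<Sum>i\<in>I. c i * g i z) = (\<Sum>i\<in>I. cnj (c i) * bergman_inner f (g i))"
proof -
  have "bergman_inner f (\<lambda>z. \<Sum>i\<in>I. c i * g i z) = (\<integral>z. (\<Sum>i\<in>I. cnj (c i) * (f z * cnj (g i z))) \<partial>disc_area)"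
    unfolding bergman_inner_def by (simp add: sum_distrib_left mult_ac)
  also have "\<dots> = (\<Sum>i\<in>I. \<integral>z. cnj (c i) * (f z * cnj (g i z)) \<partial>disc_area)"
    by (rule Bochner_Integration.integral_sum)
      (use assms in \<open>auto intro!: integrable_mult_right bergman_inner_integrable\<close>)
  finally show ?thesis by (simp add: bergman_inner_def)
qed

text \<open>A function of norm 0 vanishes almost everywhere on the disc; by continuity the set where
  it does not vanish is open, and an open null set is empty. This definiteness is what makes the
  \<open>THE\<close> in the kernel and in the adjoint unambiguous.\<close>

lemma bergman_inner_self_eq_0:
  assumes f: "f \<in> bergman_space" and z: "bergman_inner f f = 0"
  shows "f = (\<lambda>z. 0)"
proof (rule ccontr)
  assume "f \<noteq> (\<lambda>z. 0)"
  then obtain w where w: "f w \<noteq> 0" by auto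
  have "bergman_inner f f = (\<integral>z. complex_of_real ((norm (f z))\<^sup>2) \<partial>disc_area)"
    unfolding bergman_inner_def by (simp add: complex_norm_square[symmetric])
  also have "\<dots> = complex_of_real (\<integral>z. (norm (f z))\<^sup>2 \<partial>disc_area)"
    by (rule integral_complex_of_real)
  finally have "(\<integral>z. (norm (f z))\<^sup>2 \<partial>disc_area) = 0" using z by simp
  then have "AE z in disc_area. (norm (f z))\<^sup>2 = 0"
    by (subst (asm) integral_nonneg_eq_0_iff_AE) (use bergman_space_integrable[OF f] in auto)
  then have "AE z in disc_area. f z = 0" by simp
  then have ae: "AE z in lborel. z \<in> ball 0 1 \<longrightarrow> f z = 0"
    unfolding disc_area_def by (subst (asm) AE_uniform_measure) (auto simp: emeasure_ball_complex)
  define S where "S = ball 0 1 \<inter> f -` (- {0})"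
  have "open S"
    unfolding S_def using f
    by (intro continuous_open_preimage holomorphic_on_imp_continuous_on bergman_space_holomorphic) auto
  moreover have "w \<in> S" using w bergman_space_outside[OF f, of w] by (auto simp: S_def)
  ultimately have "\<not> negligible S" using open_not_negligible[of S] by auto
  moreover have "S \<in> null_sets lborel"
  proof -
    have "AE z in lborel. z \<notin> S" using ae by eventually_elim (auto simp: S_def)
    then show ?thesis using \<open>open S\<close> by (subst (asm) AE_iff_null_sets[symmetric]) auto
  qed
  then have "negligible S" by (simp add: negligible_iff_null_sets null_sets_completionI)
  ultimately show False by blast
qed

lemma bergman_eqI:
  assumes g: "g \<in> bergman_space" and h: "h \<in> bergman_space"
    and eq: "\<And>f. f \<in> bergman_space \<Longrightarrow> bergman_inner f g = bergman_inner f h"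
  shows "g = h"
proof -
  have d: "(\<lambda>z. g z - h z) \<in> bergman_space" using g h by (rule bergman_space_diff)
  have "bergman_inner (\<lambda>z. g z - h z) (\<lambda>z. g z - h z) = 0"
    using bergman_inner_diff_right[OF d g h] eq[OF d] by simp
  from bergman_inner_self_eq_0[OF d this] show ?thesis by (simp add: fun_eq_iff)
qed

text \<open>The explicit kernel \<open>1 / (1 - cnj \<alpha> * z)^2\<close> is bounded on the disc
  because \<open>norm \<alpha> < 1\<close>, hence lies in the space. Its reproducing formula is the
  limit of the one on discs of radius below 1, and the normalization of area removes the factor
  \<open>pi\<close>.\<close>

lemma bergman_reproducing:
  assumes \<alpha>: "\<alpha> \<in> ball 0 1"
  shows "bergman_kernel \<alpha> \<in> bergman_space"
    and "\<And>f. f \<in> bergman_space \<Longrightarrow> bergman_inner f (bergman_kernel \<alpha>) = f \<alpha>"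
proof -
  define k where "k = (\<lambda>z. 1 / (1 - cnj \<alpha> * z)\<^sup>2 * indicator (ball 0 1) z)"
  have lower: "1 - norm \<alpha> \<le> norm (1 - cnj \<alpha> * z)" if "z \<in> ball 0 1" for z
  proof -
    have "norm (cnj \<alpha> * z) \<le> norm \<alpha>" using that by (simp add: norm_mult mult_left_le)
    then show ?thesis using norm_triangle_ineq2[of 1 "cnj \<alpha> * z"] by simp
  qed
  have ne: "1 - cnj \<alpha> * z \<noteq> 0" if "z \<in> ball 0 1" for z
    using lower[OF that] \<alpha> by auto
  have k: "k \<in> bergman_space"
    unfolding k_def
  proof (rule bergman_space_bounded[where B = "1 / (1 - norm \<alpha>)\<^sup>2"])
    show "(\<lambda>z. 1 / (1 - cnj \<alpha> * z)\<^sup>2) holomorphic_on ball 0 1"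
      using ne by (intro holomorphic_intros) auto
    show "norm (1 / (1 - cnj \<alpha> * z)\<^sup>2) \<le> 1 / (1 - norm \<alpha>)\<^sup>2" if "z \<in> ball 0 1" for z
      unfolding norm_divide norm_power using lower[OF that] \<alpha>
      by (intro frac_le power_mono) auto
  qed
  have rep: "bergman_inner f k = f \<alpha>" if f: "f \<in> bergman_space" for f
  proof -
    \<comment> \<open>The offset 2 keeps \<open>r 0\<close> positive: the radii start at 1/2 and
      increase to 1.\<close>
    define r where "r = (\<lambda>n. 1 - 1 / (real n + 2))"
    have r: "0 < r n" "r n < 1" for n by (auto simp: r_def field_simps)
    have rlim: "r \<longlonglongrightarrow> 1" unfolding r_def by real_asymp
    have inc: "incseq (\<lambda>n. ball (0::complex) (r n))"
    proof (rule incseq_SucI)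
      have "r n \<le> r (Suc n)" for n by (simp add: r_def frac_le)
      then show "ball (0::complex) (r n) \<le> ball 0 (r (Suc n))" for n by (simp add: subset_ball)
    qed
    have un: "(\<Union>n. ball 0 (r n)) = ball (0::complex) 1"
    proof (intro equalityI subsetI)
      fix z :: complex assume "z \<in> ball 0 1"
      then have "eventually (\<lambda>n. norm z < r n) sequentially"
        using rlim by (intro order_tendstoD) auto
      then show "z \<in> (\<Union>n. ball 0 (r n))" by (auto simp: eventually_sequentially)
    qed (use r in \<open>auto intro: less_trans\<close>)
    have m: "(\<lambda>z. f z * cnj (k z)) \<in> borel_measurable borel"
      using borel_measurable_integrable[OF bergman_inner_integrable[OF f k]]
      unfolding borel_measurable_disc_area .
    have int: "set_integrable lborel (\<Union>n. ball 0 (r n)) (\<lambda>z. f z * cnj (k z))"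
      using bergman_inner_integrable[OF f k] unfolding un integrable_disc_area_iff[OF m] .
    have "(\<lambda>n. LINT z:ball 0 (r n)|lborel. f z * cnj (k z)) \<longlonglongrightarrow> (LINT z:ball 0 1|lborel. f z * cnj (k z))"
      using set_integral_cont_up[OF _ inc int] unfolding un by simp
    moreover have "(LINT z:ball 0 (r n)|lborel. f z * cnj (k z)) = pi * of_real ((r n)\<^sup>2) * f (of_real ((r n)\<^sup>2) * \<alpha>)" for n
    proof -
      have "(LINT z:ball 0 (r n)|lborel. f z * cnj (k z)) = (LINT z:ball 0 (r n)|lborel. f z * cnj (1 / (1 - cnj \<alpha> * z)\<^sup>2))"
        by (rule set_lebesgue_integral_cong) (use r[of n] in \<open>auto simp: k_def\<close>)
      then show ?thesis
        using set_integral_kernel_ball[OF bergman_space_holomorphic[OF f] r \<alpha>] by simp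
    qed
    moreover have "(\<lambda>n. pi * of_real ((r n)\<^sup>2) * f (of_real ((r n)\<^sup>2) * \<alpha>)) \<longlonglongrightarrow> pi * of_real (1\<^sup>2) * f (of_real (1\<^sup>2) * \<alpha>)"
    proof (intro tendsto_intros rlim)
      have "isCont f \<alpha>"
        using holomorphic_on_imp_continuous_on[OF bergman_space_holomorphic[OF f]] \<alpha>
        by (simp add: continuous_on_eq_continuous_at)
      moreover have "(\<lambda>n. of_real ((r n)\<^sup>2) * \<alpha>) \<longlonglongrightarrow> of_real (1\<^sup>2) * \<alpha>"
        by (intro tendsto_intros rlim)
      ultimately show "(\<lambda>n. f (of_real ((r n)\<^sup>2) * \<alpha>)) \<longlonglongrightarrow> f (of_real (1\<^sup>2) * \<alpha>)"
        by (intro isCont_tendsto_compose[of _ f]) auto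
    qed
    ultimately have "(LINT z:ball 0 1|lborel. f z * cnj (k z)) = pi * f \<alpha>"
      using LIMSEQ_unique by fastforce
    then show ?thesis
      unfolding bergman_inner_def integral_disc_area[OF m] by (simp add: scaleR_conv_of_real)
  qed
  have "bergman_kernel \<alpha> = k"
    unfolding bergman_kernel_def
  proof (rule the_equality)
    show "k \<in> bergman_space \<and> (\<forall>f\<in>bergman_space. f \<alpha> = bergman_inner f k)"
      using k rep by auto
    show "k' = k" if "k' \<in> bergman_space \<and> (\<forall>f\<in>bergman_space. f \<alpha> = bergman_inner f k')" for k'
      using that k rep by (intro bergman_eqI) auto
  qed
  then show "bergman_kernel \<alpha> \<in> bergman_space"
    "\<And>f. f \<in> bergman_space \<Longrightarrow> bergman_inner f (bergman_kernel \<alpha>) = f \<alpha>"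
    using k rep by auto
qed

text \<open>One function \<open>h\<close> with the defining property identifies the adjoint at
  \<open>g\<close>, since two such functions have the same inner products with the whole
  space.\<close>

lemma bergman_adjoint_eqI:
  assumes "h \<in> bergman_space"
    "\<And>f. f \<in> bergman_space \<Longrightarrow> bergman_inner (W f) g = bergman_inner f h"
  shows "bergman_adjoint W g = h"
  unfolding bergman_adjoint_def
  using assms by (intro the_equality) (auto intro: bergman_eqI)


subsection \<open>Fibres of a map under which all moments vanish\<close>

text \<open>This is Stone-Weierstrass: the image of \<open>h\<close> under \<phi> annihilates all
  polynomials in \<open>z\<close> and \<open>cnj z\<close>, which are uniformly dense in the
  continuous functions on the closed disc, where \<phi> takes almost all its values. Uniform
  approximation suffices because \<open>h\<close> is integrable.\<close>

lemma integral_continuous_compose_eq_0: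
  fixes \<phi> h :: "'a \<Rightarrow> complex" and \<psi> :: "complex \<Rightarrow> real"
  assumes \<phi> [measurable]: "\<phi> \<in> borel_measurable M" and h: "integrable M h"
    and \<phi>1: "AE x in M. norm (\<phi> x) \<le> 1"
    and moments: "\<And>k l. (\<integral>x. \<phi> x ^ k * cnj (\<phi> x) ^ l * h x \<partial>M) = 0"
    and \<psi>: "continuous_on UNIV \<psi>"
  shows "(\<integral>x. complex_of_real (\<psi> (\<phi> x)) * h x \<partial>M) = 0"
proof -
  have hm [measurable]: "h \<in> borel_measurable M" using h by auto
  have bd: "\<exists>K. \<forall>z. norm z \<le> 1 \<longrightarrow> norm (v z) \<le> K" if "continuous_on UNIV v" for v :: "complex \<Rightarrow> complex"
  proof -
    have "compact (v ` cball 0 1)"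
      using that by (intro compact_continuous_image) (auto intro: continuous_on_subset)
    from compact_imp_bounded[OF this] obtain K where "\<forall>x\<in>v ` cball 0 1. norm x \<le> K"
      unfolding bounded_iff by blast
    then show ?thesis by (intro exI[of _ K]) auto
  qed
  have int: "integrable M (\<lambda>x. v (\<phi> x) * h x)" if v: "continuous_on UNIV v" for v :: "complex \<Rightarrow> complex"
  proof -
    obtain K where K: "\<And>z. norm z \<le> 1 \<Longrightarrow> norm (v z) \<le> K" using bd[OF v] by auto
    show ?thesis
    proof (rule Bochner_Integration.integrable_bound)
      show "integrable M (\<lambda>x. K * norm (h x))" using h by (intro integrable_mult_right integrable_norm)
      show "(\<lambda>x. v (\<phi> x) * h x) \<in> borel_measurable M"
        by (intro borel_measurable_times borel_measurable_continuous_on[OF v] \<phi> hm)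
      show "AE x in M. norm (v (\<phi> x) * h x) \<le> norm (K * norm (h x))"
        using \<phi>1 by eventually_elim
          (auto simp: norm_mult abs_mult intro!: mult_right_mono order_trans[OF K abs_ge_self])
    qed
  qed
  \<comment> \<open>\<open>A u\<close> asks for vanishing against all monomials at once, so that
    multiplying \<open>u\<close> by \<open>z\<close> or \<open>cnj z\<close> merely shifts
    \<open>k\<close> or \<open>l\<close>. The induction over polynomials can then absorb one factor
    at a time.\<close>
  define A where "A = (\<lambda>u. continuous_on UNIV u \<and> (\<forall>k l. (\<integral>x. u (\<phi> x) * \<phi> x ^ k * cnj (\<phi> x) ^ l * h x \<partial>M) = 0))"
  have intA: "integrable M (\<lambda>x. u (\<phi> x) * \<phi> x ^ k * cnj (\<phi> x) ^ l * h x)" if "A u" for u k l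
  proof -
    have "continuous_on UNIV (\<lambda>z. u z * z ^ k * cnj z ^ l)"
      using that by (auto simp: A_def intro!: continuous_intros)
    from int[OF this] show ?thesis .
  qed
  have A_add: "A (\<lambda>z. u z + v z)" if "A u" "A v" for u v
    using that intA[OF that(1)] intA[OF that(2)]
    by (auto simp: A_def distrib_right intro!: continuous_intros)
  have A_cmult: "A (\<lambda>z. c * u z)" if "A u" for u c
    using that by (auto simp: A_def mult.assoc intro!: continuous_intros)
  have A_id: "A (\<lambda>z. z * u z)" if "A u" for u
    unfolding A_def
  proof (intro conjI allI)
    show "continuous_on UNIV (\<lambda>z. z * u z)" using that by (auto simp: A_def intro!: continuous_intros)
    fix k l
    have "(\<integral>x. u (\<phi> x) * \<phi> x ^ Suc k * cnj (\<phi> x) ^ l * h x \<partial>M) = 0"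
      using that unfolding A_def by blast
    then show "(\<integral>x. \<phi> x * u (\<phi> x) * \<phi> x ^ k * cnj (\<phi> x) ^ l * h x \<partial>M) = 0"
      by (simp add: mult_ac)
  qed
  have A_cnj: "A (\<lambda>z. cnj z * u z)" if "A u" for u
    unfolding A_def
  proof (intro conjI allI)
    show "continuous_on UNIV (\<lambda>z. cnj z * u z)" using that by (auto simp: A_def intro!: continuous_intros)
    fix k l
    have "(\<integral>x. u (\<phi> x) * \<phi> x ^ k * cnj (\<phi> x) ^ Suc l * h x \<partial>M) = 0"
      using that unfolding A_def by blast
    then show "(\<integral>x. cnj (\<phi> x) * u (\<phi> x) * \<phi> x ^ k * cnj (\<phi> x) ^ l * h x \<partial>M) = 0"
      by (simp add: mult_ac)
  qed
  have poly: "A (\<lambda>z. of_real (p z) * u z)" if "real_polynomial_function p" "A u" for p :: "complex \<Rightarrow> real" and u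
    using that
  proof (induction arbitrary: u rule: real_polynomial_function.induct)
    case (linear f)
    \<comment> \<open>A real-linear form on the plane is a combination of \<open>z\<close> and
      \<open>cnj z\<close>; the coefficients are read off from its values at 1 and \<i>.\<close>
    define c where "c = (of_real (f 1) - \<i> * of_real (f \<i>)) / 2"
    define d where "d = (of_real (f 1) + \<i> * of_real (f \<i>)) / 2"
    have eq: "complex_of_real (f z) = c * z + d * cnj z" for z
    proof -
      have "z = Re z *\<^sub>R 1 + Im z *\<^sub>R \<i>" by (simp add: complex_eq_iff)
      then have "f z = f (Re z *\<^sub>R 1 + Im z *\<^sub>R \<i>)" by simp
      also have "\<dots> = Re z * f 1 + Im z * f \<i>"
        using linear(1) by (simp only: linear_simps real_scaleR_def)
      finally show ?thesis
        by (simp add: c_def d_def complex_eq_iff field_simps)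
    qed
    have "A (\<lambda>z. c * (z * u z) + d * (cnj z * u z))"
      by (intro A_add A_cmult A_id A_cnj linear)
    then show ?case by (simp add: eq distrib_right mult.assoc)
  next
    case (const c)
    then show ?case by (rule A_cmult)
  next
    case (add f g)
    have "A (\<lambda>z. of_real (f z) * u z + of_real (g z) * u z)"
      using add by (intro A_add) auto
    then show ?case by (simp add: distrib_right)
  next
    case (mult f g)
    have "A (\<lambda>z. of_real (f z) * (of_real (g z) * u z))"
      using mult by auto
    then show ?case by (simp add: mult.assoc)
  qed
  have A1: "A (\<lambda>z. 1)" using moments by (simp add: A_def)
  have poly0: "(\<integral>x. complex_of_real (p (\<phi> x)) * h x \<partial>M) = 0"
    if "real_polynomial_function p" for p
    using poly[OF that A1] unfolding A_def by (elim conjE allE[of _ 0]) simp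
  let ?I = "\<integral>x. complex_of_real (\<psi> (\<phi> x)) * h x \<partial>M"
  have le: "norm ?I \<le> e * (\<integral>x. norm (h x) \<partial>M)" if e: "e > 0" for e
  proof -
    obtain p where p: "real_polynomial_function p" "\<And>z. z \<in> cball 0 1 \<Longrightarrow> \<bar>\<psi> z - p z\<bar> < e"
      using Stone_Weierstrass_real_polynomial_function[of "cball 0 1" \<psi> e] e \<psi>
      by (auto intro: continuous_on_subset)
    have cp: "continuous_on UNIV p"
      using continuous_real_polymonial_function[OF p(1)] by (simp add: continuous_at_imp_continuous_on)
    have i1: "integrable M (\<lambda>x. complex_of_real (\<psi> (\<phi> x)) * h x)"
      by (rule int) (intro continuous_intros \<psi>)
    have i2: "integrable M (\<lambda>x. complex_of_real (p (\<phi> x)) * h x)"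
      by (rule int) (intro continuous_intros cp)
    have "?I = (\<integral>x. complex_of_real (\<psi> (\<phi> x)) * h x - complex_of_real (p (\<phi> x)) * h x \<partial>M)"
      using poly0[OF p(1)] by (subst Bochner_Integration.integral_diff[OF i1 i2]) simp
    also have "norm \<dots> \<le> (\<integral>x. norm (complex_of_real (\<psi> (\<phi> x)) * h x - complex_of_real (p (\<phi> x)) * h x) \<partial>M)"
      by (rule integral_norm_bound)
    also have "\<dots> \<le> (\<integral>x. e * norm (h x) \<partial>M)"
    proof (rule integral_mono_AE)
      show "integrable M (\<lambda>x. norm (complex_of_real (\<psi> (\<phi> x)) * h x - complex_of_real (p (\<phi> x)) * h x))"
        using i1 i2 by (intro integrable_norm Bochner_Integration.integrable_diff)
      show "integrable M (\<lambda>x. e * norm (h x))" using h by simp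
      show "AE x in M. norm (complex_of_real (\<psi> (\<phi> x)) * h x - complex_of_real (p (\<phi> x)) * h x) \<le> e * norm (h x)"
        using \<phi>1
      proof eventually_elim
        case (elim x)
        have "norm (complex_of_real (\<psi> (\<phi> x)) * h x - complex_of_real (p (\<phi> x)) * h x) =
            \<bar>\<psi> (\<phi> x) - p (\<phi> x)\<bar> * norm (h x)"
          by (simp flip: left_diff_distrib of_real_diff add: norm_mult)
        then show ?case using p(2)[of "\<phi> x"] elim by (simp add: mult_right_mono)
      qed
    qed
    finally show ?thesis by simp
  qed
  have "norm ?I \<le> 0"
  proof (rule field_le_epsilon)
    fix \<epsilon> :: real assume "\<epsilon> > 0"
    define J where "J = (\<integral>x. norm (h x) \<partial>M)"
    have J: "J \<ge> 0" by (simp add: J_def)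
    \<comment> \<open>The denominator \<open>J + 1\<close> stays positive when
      \<open>J = 0\<close>.\<close>
    have "norm ?I \<le> \<epsilon> / (J + 1) * J" unfolding J_def using \<open>\<epsilon> > 0\<close> J by (intro le) (simp add: J_def add_nonneg_pos)
    also have "\<dots> \<le> \<epsilon>" using \<open>\<epsilon> > 0\<close> J by (simp add: field_simps)
    finally show "norm ?I \<le> 0 + \<epsilon>" by simp
  qed
  then show ?thesis by simp
qed

section \<open>Concentration of shrinking bumps at a regular point\<close>

lemma integral_lborel_affine_complex:
  fixes f :: "complex \<Rightarrow> 'b::{banach,second_countable_topology}"
  assumes f: "f \<in> borel_measurable borel" and c: "c > 0"
  shows "(LINT u|lborel. f (p + c *\<^sub>R u)) = (1 / c\<^sup>2) *\<^sub>R (LINT z|lborel. f z)"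
proof -
  have [measurable]: "(\<lambda>u::complex. p + c *\<^sub>R u) \<in> borel_measurable borel" by simp
  have "(LINT z|lborel. f z) = (LINT z|density (distr lborel borel (\<lambda>u. p + c *\<^sub>R u)) (\<lambda>_. ennreal (c\<^sup>2)). f z)"
    using lborel_affine[of c p] c by simp
  also have "\<dots> = (LINT z|distr lborel borel (\<lambda>u. p + c *\<^sub>R u). c\<^sup>2 *\<^sub>R f z)"
    by (rule integral_density) (use f in auto)
  also have "\<dots> = (LINT u|lborel. c\<^sup>2 *\<^sub>R f (p + c *\<^sub>R u))"
    by (rule integral_distr) (use f in auto)
  also have "\<dots> = c\<^sup>2 *\<^sub>R (LINT u|lborel. f (p + c *\<^sub>R u))" by simp
  finally show ?thesis using c by simp
qed

text \<open>On nonnegative arguments this is a tent with value 1 at 0 that vanishes from 1 on.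
  Applied to \<open>n * norm (\<phi> z - w)\<close> it gives test functions whose support shrinks to
  the fibre over \<open>w\<close>.\<close>

definition bump :: "real \<Rightarrow> real" where "bump t = max 0 (1 - t)"

lemma bump_bounds: "0 \<le> bump t" "t \<ge> 0 \<Longrightarrow> bump t \<le> 1"
  by (auto simp: bump_def)

lemma bump_eq_0: "t \<ge> 1 \<Longrightarrow> bump t = 0"
  by (simp add: bump_def)

lemma continuous_on_bump [continuous_intros]:
  "continuous_on S f \<Longrightarrow> continuous_on S (\<lambda>x. bump (f x))"
  unfolding bump_def by (intro continuous_intros)

lemma isCont_bump: "isCont bump t"
  using continuous_on_bump[OF continuous_on_id[of UNIV]] by (simp add: continuous_on_eq_continuous_at)

lemma integral_bump_pos: "(LINT u|lborel. bump (norm (u::complex))) > 0"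
proof -
  have i: "integrable lborel (\<lambda>u::complex. bump (norm u))"
  proof -
    have "integrable lborel (\<lambda>u::complex. indicator (cball 0 1) u *\<^sub>R bump (norm u))"
      by (intro borel_integrable_compact continuous_intros) auto
    also have "(\<lambda>u::complex. indicator (cball 0 1) u *\<^sub>R bump (norm u)) = (\<lambda>u. bump (norm u))"
      by (auto simp: indicator_def bump_def fun_eq_iff)
    finally show ?thesis .
  qed
  have "0 < measure lborel (ball (0::complex) (1/2)) * (1/2)"
    by (simp add: measure_ball_complex)
  also have "\<dots> = (LINT u|lborel. indicator (ball (0::complex) (1/2)) u * (1/2))" by simp
  also have "\<dots> \<le> (LINT u|lborel. bump (norm (u::complex)))"
  proof (rule integral_mono[OF _ i])
    show "integrable lborel (\<lambda>u. indicator (ball (0::complex) (1/2)) u * (1/2 :: real))"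
      by (intro integrable_mult_left integrable_real_indicator) (auto simp: emeasure_ball_complex)
  qed (auto simp: indicator_def bump_def)
  finally show ?thesis .
qed

text \<open>The substitution \<open>z = p + u / (n + 1)\<close> cancels the factor
  \<open>(n + 1)^2\<close> and turns the argument of the bump into a scaled difference quotient with
  limit \<open>norm (d * u)\<close>. The limit integrand sees \<open>d\<close> only through its
  modulus, and one more scaling extracts \<open>1 / |d|^2\<close>, the inverse Jacobian. The bound
  \<open>lower\<close> confines all integrands to the disc of radius \<open>1 / c\<close> in
  \<open>u\<close>, which supplies the dominating function.\<close>

lemma bump_concentration:
  fixes \<phi> h :: "complex \<Rightarrow> complex"
  assumes \<eta>: "\<eta> > 0" and c: "c > 0" and d: "(\<phi> has_field_derivative d) (at p)" "d \<noteq> 0"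
    and lower: "\<And>z. z \<in> ball p \<eta> \<Longrightarrow> c * norm (z - p) \<le> norm (\<phi> z - \<phi> p)"
    and \<phi>: "continuous_on (ball p \<eta>) \<phi>" and h: "continuous_on (cball p \<eta>) h"
  shows "(\<lambda>n. of_real ((real (Suc n))\<^sup>2) * (LINT z:ball p \<eta>|lborel. of_real (bump (real (Suc n) * norm (\<phi> z - \<phi> p))) * h z))
    \<longlonglongrightarrow> h p / of_real ((norm d)\<^sup>2) * of_real (LINT u|lborel. bump (norm (u::complex)))"
proof -
  define F where "F = (\<lambda>n z. indicator (ball p \<eta>) z *\<^sub>R (of_real (bump (real (Suc n) * norm (\<phi> z - \<phi> p))) * h z))"
  define G where "G = (\<lambda>n u. F n (p + (1 / real (Suc n)) *\<^sub>R u))"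
  have Fm: "F n \<in> borel_measurable borel" for n
    unfolding F_def by (intro borel_measurable_continuous_on_indicator continuous_intros \<phi>
      continuous_on_subset[OF h]) auto
  have Gm: "G n \<in> borel_measurable borel" for n
    unfolding G_def using Fm by measurable
  have eq: "of_real ((real (Suc n))\<^sup>2) * (LINT z:ball p \<eta>|lborel. of_real (bump (real (Suc n) * norm (\<phi> z - \<phi> p))) * h z)
      = (LINT u|lborel. G n u)" for n
    unfolding G_def using integral_lborel_affine_complex[OF Fm, of "1 / real (Suc n)" n p]
    by (simp add: F_def set_lebesgue_integral_def power_one_over scaleR_conv_of_real del: of_nat_Suc)
  have "bounded (h ` cball p \<eta>)"
    using h by (intro compact_imp_bounded compact_continuous_image) auto
  then obtain K where K: "\<And>z. z \<in> cball p \<eta> \<Longrightarrow> norm (h z) \<le> K" unfolding bounded_iff by (metis imageI)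
  have K0: "K \<ge> 0" using order_trans[OF norm_ge_zero K[of p]] \<eta> by simp
  have "(\<lambda>n. LINT u|lborel. G n u) \<longlonglongrightarrow> (LINT u|lborel. of_real (bump (norm (d * u))) * h p)"
  proof (rule integral_dominated_convergence)
    show "(\<lambda>u. of_real (bump (norm (d * u))) * h p) \<in> borel_measurable lborel"
      by (simp, intro borel_measurable_continuous_onI continuous_intros)
    show "integrable lborel (\<lambda>u::complex. indicator (cball 0 (1 / c)) u * K)"
      by (intro integrable_mult_left integrable_real_indicator)
        (use emeasure_lborel_cball_finite[of "0::complex" "1 / c"] in auto)
    show "AE u in lborel. norm (G n u) \<le> indicator (cball 0 (1 / c)) u * K" for n
    proof (rule AE_I2)
      fix u :: complex
      define z where "z = p + (1 / real (Suc n)) *\<^sub>R u"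
      show "norm (G n u) \<le> indicator (cball 0 (1 / c)) u * K"
      proof (cases "z \<in> ball p \<eta>")
        case True
        have "c * norm u = real (Suc n) * (c * norm (z - p))" by (simp add: z_def del: of_nat_Suc)
        also have "\<dots> \<le> real (Suc n) * norm (\<phi> z - \<phi> p)" by (intro mult_left_mono lower True) simp
        finally have le: "c * norm u \<le> real (Suc n) * norm (\<phi> z - \<phi> p)" .
        have G: "G n u = of_real (bump (real (Suc n) * norm (\<phi> z - \<phi> p))) * h z"
          using True by (simp add: G_def F_def z_def)
        show ?thesis
        proof (cases "u \<in> cball 0 (1 / c)")
          case u: True
          have "norm (G n u) \<le> 1 * K"
            unfolding G norm_mult using bump_bounds[of "real (Suc n) * norm (\<phi> z - \<phi> p)"] K[of z] True K0
            by (intro mult_mono) auto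
          with u show ?thesis by simp
        next
          case False
          then have "1 \<le> c * norm u" using c by (simp add: field_simps)
          then have "G n u = 0" using le unfolding G by (simp add: bump_eq_0 del: of_nat_Suc)
          then show ?thesis using K0 by (simp add: indicator_def)
        qed
      next
        case False
        then have "G n u = 0" by (simp add: G_def F_def z_def)
        then show ?thesis using K0 by (simp add: indicator_def)
      qed
    qed
    show "AE u in lborel. (\<lambda>n. G n u) \<longlonglongrightarrow> of_real (bump (norm (d * u))) * h p"
    proof (rule AE_I2)
      fix u :: complex
      define x where "x = (\<lambda>n. (1 / real (Suc n)) *\<^sub>R u)"
      have x0: "x \<longlonglongrightarrow> 0"
        unfolding x_def using tendsto_scaleR[OF LIMSEQ_inverse_real_of_nat tendsto_const[of u]]
        by (simp add: inverse_eq_divide)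
      have px: "(\<lambda>n. p + x n) \<longlonglongrightarrow> p" using tendsto_add[OF tendsto_const[of p] x0] by simp
      have ev: "eventually (\<lambda>n. p + x n \<in> ball p \<eta>) sequentially"
        using px \<eta> by (intro topological_tendstoD) auto
      have "isCont h p" using h \<eta> continuous_on_interior[of "cball p \<eta>" h p] by simp
      then have hx: "(\<lambda>n. h (p + x n)) \<longlonglongrightarrow> h p" using px by (rule isCont_tendsto_compose)
      have quot: "(\<lambda>n. real (Suc n) * norm (\<phi> (p + x n) - \<phi> p)) \<longlonglongrightarrow> norm (d * u)"
      proof (cases "u = 0")
        case True
        then show ?thesis by (simp add: x_def)
      next
        case False
        have "((\<lambda>h. (\<phi> (p + h) - \<phi> p) / h) \<longlongrightarrow> d) (at 0)" using d(1) by (simp add: DERIV_def)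
        moreover have "filterlim x (at 0) sequentially"
          using x0 False by (auto simp: filterlim_at x_def)
        ultimately have "(\<lambda>n. (\<phi> (p + x n) - \<phi> p) / x n) \<longlonglongrightarrow> d" by (rule filterlim_compose)
        then have "(\<lambda>n. norm ((\<phi> (p + x n) - \<phi> p) / x n * u)) \<longlonglongrightarrow> norm (d * u)"
          by (intro tendsto_intros)
        moreover have "norm ((\<phi> (p + x n) - \<phi> p) / x n * u) = real (Suc n) * norm (\<phi> (p + x n) - \<phi> p)" for n
        proof -
          have "D / x n * u = of_nat (Suc n) * D" for D
            using False by (simp add: x_def scaleR_conv_of_real del: of_nat_Suc)
          then show ?thesis by (simp only: norm_mult norm_of_nat)
        qed
        ultimately show ?thesis by simp
      qed
      have "(\<lambda>n. of_real (bump (real (Suc n) * norm (\<phi> (p + x n) - \<phi> p))) * h (p + x n)) \<longlonglongrightarrow> of_real (bump (norm (d * u))) * h p"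
        by (intro tendsto_intros hx isCont_tendsto_compose[OF isCont_bump quot])
      then show "(\<lambda>n. G n u) \<longlonglongrightarrow> of_real (bump (norm (d * u))) * h p"
        by (rule Lim_transform_eventually)
          (use ev in \<open>eventually_elim, simp add: G_def F_def x_def del: of_nat_Suc\<close>)
    qed
  qed (use Gm in auto)
  also have "(LINT u|lborel. of_real (bump (norm (d * u))) * h p) = of_real (LINT u|lborel. bump (norm (d * u))) * h p"
    by (subst integral_mult_left_zero) (simp add: integral_complex_of_real)
  also have "(LINT u|lborel. bump (norm (d * u))) = (LINT u|lborel. bump (norm (0 + norm d *\<^sub>R (u::complex))))"
    by (simp add: norm_mult)
  also have "\<dots> = (1 / (norm d)\<^sup>2) *\<^sub>R (LINT u|lborel. bump (norm (u::complex)))"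
    by (rule integral_lborel_affine_complex[where f = "\<lambda>u. bump (norm u)"])
      (use d in \<open>auto intro!: borel_measurable_continuous_onI continuous_intros\<close>)
  finally show ?thesis unfolding eq by (simp add: mult_ac)
qed

text \<open>The hypothesis on the moments says that the image under \<open>\<phi>\<close> of the complex measure with
  density \<open>h\<close> vanishes; the left-hand side is the density of that image at the regular value
  \<open>w\<close>.  It is isolated by testing against bumps shrinking to \<open>w\<close>, which replaces a change of
  variables.\<close>

lemma sum_fiber_eq_0:
  fixes \<phi> h :: "complex \<Rightarrow> complex"
  assumes \<phi>_hol: "\<phi> holomorphic_on ball 0 1" and \<phi>_cont: "continuous_on (cball 0 1) \<phi>"
    and \<phi>_m: "\<phi> \<in> borel_measurable borel"
    and \<phi>_sphere: "\<And>z. norm z = 1 \<Longrightarrow> norm (\<phi> z) = 1" and \<phi>_ball: "\<And>z. z \<in> ball 0 1 \<Longrightarrow> norm (\<phi> z) < 1"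
    and h_int: "integrable disc_area h" and h_cont: "continuous_on (ball 0 1) h"
    and moments: "\<And>k l. (\<integral>z. \<phi> z ^ k * cnj (\<phi> z) ^ l * h z \<partial>disc_area) = 0"
    and w: "norm w < 1" and P: "P = {z \<in> ball 0 1. \<phi> z = w}" "finite P"
    and simple: "\<And>p. p \<in> P \<Longrightarrow> deriv \<phi> p \<noteq> 0"
  shows "(\<Sum>p\<in>P. h p / of_real ((norm (deriv \<phi> p))\<^sup>2)) = 0"
proof -
  have dphi: "(\<phi> has_field_derivative deriv \<phi> p) (at p)" if "p \<in> P" for p
    using that P \<phi>_hol by (intro holomorphic_derivI[of _ "ball 0 1"]) auto
  have h_m: "h \<in> borel_measurable borel"
    using borel_measurable_integrable[OF h_int] unfolding borel_measurable_disc_area .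
  \<comment> \<open>The conditions are stated as eventual properties of the radius so that finitely
    many points can share one. The linearization error takes at most half of
    \<open>norm (deriv \<phi> p)\<close>, and the other half remains as lower slope.\<close>
  have ev: "eventually (\<lambda>\<eta>. cball p \<eta> \<subseteq> ball 0 1 \<and>
      (\<forall>z\<in>ball p \<eta>. norm (deriv \<phi> p) / 2 * norm (z - p) \<le> norm (\<phi> z - \<phi> p)) \<and>
      (\<forall>q\<in>P. q \<noteq> p \<longrightarrow> ball p \<eta> \<inter> ball q \<eta> = {})) (at_right 0)" if p: "p \<in> P" for p
  proof (intro eventually_conj)
    obtain e where e: "e > 0" "cball p e \<subseteq> ball 0 1"
      using p P open_contains_cball[of "ball (0::complex) 1"] by blast
    show "eventually (\<lambda>\<eta>. cball p \<eta> \<subseteq> ball 0 1) (at_right 0)"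
      unfolding eventually_at_right_field using e by (intro exI[of _ e]) auto
    have "(\<phi> has_derivative (*) (deriv \<phi> p)) (at p)"
      using dphi[OF p] by (simp add: has_field_derivative_def)
    moreover have "norm (deriv \<phi> p) / 2 > 0" using simple[OF p] by simp
    ultimately obtain d where d: "d > 0"
      "\<And>z. norm (z - p) < d \<Longrightarrow> norm (\<phi> z - \<phi> p - deriv \<phi> p * (z - p)) \<le> norm (deriv \<phi> p) / 2 * norm (z - p)"
      unfolding has_derivative_at_alt by metis
    have "norm (deriv \<phi> p) / 2 * norm (z - p) \<le> norm (\<phi> z - \<phi> p)" if "z \<in> ball p d" for z
    proof -
      have "norm (deriv \<phi> p) * norm (z - p) \<le> norm (\<phi> z - \<phi> p) + norm (\<phi> z - \<phi> p - deriv \<phi> p * (z - p))"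
        using norm_triangle_ineq4[of "\<phi> z - \<phi> p" "\<phi> z - \<phi> p - deriv \<phi> p * (z - p)"]
        by (simp add: norm_mult)
      then show ?thesis using d(2)[of z] that by (simp add: dist_norm norm_minus_commute)
    qed
    then show "eventually (\<lambda>\<eta>. \<forall>z\<in>ball p \<eta>. norm (deriv \<phi> p) / 2 * norm (z - p) \<le> norm (\<phi> z - \<phi> p)) (at_right 0)"
      unfolding eventually_at_right_field using d by (intro exI[of _ d]) auto
    show "eventually (\<lambda>\<eta>. \<forall>q\<in>P. q \<noteq> p \<longrightarrow> ball p \<eta> \<inter> ball q \<eta> = {}) (at_right 0)"
    proof (rule eventually_ball_finite[OF P(2)], rule ballI)
      fix q assume "q \<in> P"
      show "eventually (\<lambda>\<eta>. q \<noteq> p \<longrightarrow> ball p \<eta> \<inter> ball q \<eta> = {}) (at_right 0)"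
      proof (cases "q = p")
        case False
        then have "eventually (\<lambda>\<eta>. \<eta> < dist p q / 2) (at_right 0)"
          by (intro order_tendstoD(2)[OF tendsto_ident_at]) auto
        then show ?thesis
          by eventually_elim (auto simp: disjoint_ballI)
      qed simp
    qed
  qed
  have "eventually (\<lambda>\<eta>::real. \<eta> > 0 \<and> (\<forall>p\<in>P. cball p \<eta> \<subseteq> ball 0 1 \<and>
      (\<forall>z\<in>ball p \<eta>. norm (deriv \<phi> p) / 2 * norm (z - p) \<le> norm (\<phi> z - \<phi> p)) \<and>
      (\<forall>q\<in>P. q \<noteq> p \<longrightarrow> ball p \<eta> \<inter> ball q \<eta> = {}))) (at_right 0)"
    using ev by (intro eventually_conj eventually_at_right_less eventually_ball_finite P(2)) auto
  from eventually_happens'[OF _ this] obtain \<eta> :: real where \<eta>: "\<eta> > 0"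
    and sub: "\<And>p. p \<in> P \<Longrightarrow> cball p \<eta> \<subseteq> ball 0 1"
    and lower: "\<And>p z. p \<in> P \<Longrightarrow> z \<in> ball p \<eta> \<Longrightarrow> norm (deriv \<phi> p) / 2 * norm (z - p) \<le> norm (\<phi> z - \<phi> p)"
    and disj: "\<And>p q. p \<in> P \<Longrightarrow> q \<in> P \<Longrightarrow> q \<noteq> p \<Longrightarrow> ball p \<eta> \<inter> ball q \<eta> = {}"
    by auto
  \<comment> \<open>On this compact set \<phi> misses \<open>w\<close>: in the open disc by the
    choice of \<open>P\<close>, on the circle because \<open>norm (\<phi> z) = 1 > norm w\<close>.
    Hence it keeps a distance \<delta> from \<open>w\<close>, and bumps of width at most \<delta>
    vanish on \<open>K\<close>.\<close>
  define K where "K = cball 0 1 - (\<Union>p\<in>P. ball p \<eta>)"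
  have "compact K" unfolding K_def by (intro compact_diff) auto
  then have "closed (\<phi> ` K)"
    by (intro compact_imp_closed compact_continuous_image continuous_on_subset[OF \<phi>_cont]) (auto simp: K_def)
  moreover have "w \<notin> \<phi> ` K"
  proof
    assume "w \<in> \<phi> ` K"
    then obtain z where z: "z \<in> K" "\<phi> z = w" by auto
    then have "norm z \<noteq> 1" using \<phi>_sphere w by auto
    then have "z \<in> P" using z P by (auto simp: K_def)
    then show False using z \<eta> by (auto simp: K_def)
  qed
  ultimately obtain \<delta> where \<delta>: "\<delta> > 0" "\<And>z. z \<in> K \<Longrightarrow> \<delta> \<le> norm (\<phi> z - w)"
    using separate_point_closed[of "\<phi> ` K" w] by (auto simp: dist_norm norm_minus_commute)
  define f where "f = (\<lambda>n z. complex_of_real (bump (real (Suc n) * norm (\<phi> z - w))) * h z)"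
  have f_m: "f n \<in> borel_measurable borel" for n
  proof -
    have "(\<lambda>z. bump (real (Suc n) * norm (\<phi> z - w))) \<in> borel_measurable borel"
      by (rule borel_measurable_continuous_on[OF _ \<phi>_m]) (intro continuous_intros)
    then show ?thesis unfolding f_def using h_m by measurable
  qed
  have f0: "(LINT z:ball 0 1|lborel. f n z) = 0" for n
  proof -
    have "(\<integral>z. complex_of_real (bump (real (Suc n) * norm (\<phi> z - w))) * h z \<partial>disc_area) = 0"
    proof (rule integral_continuous_compose_eq_0[OF _ h_int _ moments])
      show "\<phi> \<in> borel_measurable disc_area" using \<phi>_m unfolding borel_measurable_disc_area .
      show "AE z in disc_area. norm (\<phi> z) \<le> 1"
        unfolding disc_area_def
        by (rule AE_uniform_measureI) (use less_imp_le[OF \<phi>_ball] in \<open>auto intro!: AE_I2\<close>)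
    qed (intro continuous_intros)
    then show ?thesis using integral_disc_area[OF f_m, of n] unfolding f_def by simp
  qed
  define J where "J = complex_of_real (LINT u|lborel. bump (norm (u::complex)))"
  have lim: "(\<lambda>n. of_real ((real (Suc n))\<^sup>2) * (LINT z:ball p \<eta>|lborel. f n z)) \<longlonglongrightarrow> h p / of_real ((norm (deriv \<phi> p))\<^sup>2) * J"
    if p: "p \<in> P" for p
  proof -
    have sb: "ball p \<eta> \<subseteq> cball 0 1"
      using order_trans[OF ball_subset_cball sub[OF p]] ball_subset_cball by blast
    have "\<phi> p = w" using p P by auto
    moreover have "(\<lambda>n. of_real ((real (Suc n))\<^sup>2) * (LINT z:ball p \<eta>|lborel. of_real (bump (real (Suc n) * norm (\<phi> z - \<phi> p))) * h z))
        \<longlonglongrightarrow> h p / of_real ((norm (deriv \<phi> p))\<^sup>2) * of_real (LINT u|lborel. bump (norm (u::complex)))"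
      by (rule bump_concentration[OF \<eta> _ dphi[OF p] simple[OF p] lower[OF p]])
        (use simple[OF p] in simp, assumption, rule continuous_on_subset[OF \<phi>_cont sb],
         rule continuous_on_subset[OF h_cont sub[OF p]])
    ultimately show ?thesis by (simp add: f_def J_def)
  qed
  have split: "(LINT z:ball 0 1|lborel. f n z) = (\<Sum>p\<in>P. (LINT z:ball p \<eta>|lborel. f n z))"
    if n: "1 / \<delta> \<le> real (Suc n)" for n
  proof -
    have int: "set_integrable lborel (ball p \<eta>) (f n)" if p: "p \<in> P" for p
    proof -
      have "set_integrable lborel (cball p \<eta>) (f n)"
        unfolding set_integrable_def f_def
        by (rule borel_integrable_compact)
          (use sub[OF p] in \<open>auto intro!: continuous_intros continuous_on_subset[OF \<phi>_cont] continuous_on_subset[OF h_cont] simp del: of_nat_Suc\<close>)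
      then show ?thesis by (rule set_integrable_subset) auto
    qed
    have "indicator (ball 0 1) z *\<^sub>R f n z = (\<Sum>p\<in>P. indicator (ball p \<eta>) z *\<^sub>R f n z)" for z
    proof (cases "\<exists>p\<in>P. z \<in> ball p \<eta>")
      case True
      then obtain p where p: "p \<in> P" "z \<in> ball p \<eta>" by auto
      have "(\<Sum>q\<in>P. indicator (ball q \<eta>) z *\<^sub>R f n z) = (\<Sum>q\<in>P. if q = p then f n z else 0)"
      proof (rule sum.cong)
        fix q assume q: "q \<in> P"
        show "indicator (ball q \<eta>) z *\<^sub>R f n z = (if q = p then f n z else 0)"
          using disj[OF p(1) q] p by (cases "q = p") (auto simp: indicator_def)
      qed simp
      moreover have "z \<in> ball 0 1" using sub[OF p(1)] p(2) ball_subset_cball by blast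
      ultimately show ?thesis using p P(2) by (simp add: sum.delta)
    next
      case False
      have "f n z = 0" if "z \<in> ball 0 1"
      proof -
        have "z \<in> K" using False that by (auto simp: K_def)
        then have "1 / \<delta> * \<delta> \<le> real (Suc n) * norm (\<phi> z - w)"
          using \<delta>(2)[of z] \<delta>(1) n by (intro mult_mono) auto
        then show ?thesis using \<delta>(1) by (simp add: f_def bump_eq_0 del: of_nat_Suc)
      qed
      then show ?thesis using False by (auto simp: indicator_def)
    qed
    then have "(LINT z:ball 0 1|lborel. f n z) = (LINT z|lborel. (\<Sum>p\<in>P. indicator (ball p \<eta>) z *\<^sub>R f n z))"
      by (simp add: set_lebesgue_integral_def)
    also have "\<dots> = (\<Sum>p\<in>P. (LINT z:ball p \<eta>|lborel. f n z))"
      unfolding set_lebesgue_integral_def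
      by (rule Bochner_Integration.integral_sum) (use int in \<open>auto simp: set_integrable_def\<close>)
    finally show ?thesis .
  qed
  have "(\<lambda>n. \<Sum>p\<in>P. of_real ((real (Suc n))\<^sup>2) * (LINT z:ball p \<eta>|lborel. f n z))
      \<longlonglongrightarrow> (\<Sum>p\<in>P. h p / of_real ((norm (deriv \<phi> p))\<^sup>2) * J)"
    by (intro tendsto_sum lim)
  moreover have "eventually (\<lambda>n. (\<Sum>p\<in>P. of_real ((real (Suc n))\<^sup>2) * (LINT z:ball p \<eta>|lborel. f n z)) = 0) sequentially"
  proof -
    obtain N where N: "1 / \<delta> \<le> real N" using real_arch_simple by blast
    have "(\<Sum>p\<in>P. of_real ((real (Suc n))\<^sup>2) * (LINT z:ball p \<eta>|lborel. f n z)) = 0" if "n \<ge> N" for n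
    proof -
      have "1 / \<delta> \<le> real (Suc n)" using N that by simp
      from split[OF this] f0[of n] show ?thesis by (simp flip: sum_distrib_left)
    qed
    then show ?thesis by (auto simp: eventually_sequentially)
  qed
  ultimately have "(\<Sum>p\<in>P. h p / of_real ((norm (deriv \<phi> p))\<^sup>2) * J) = 0"
    by (rule LIMSEQ_unique[OF _ tendsto_eventually])
  then have "(\<Sum>p\<in>P. h p / of_real ((norm (deriv \<phi> p))\<^sup>2)) * J = 0"
    by (simp only: sum_distrib_right)
  moreover have "J \<noteq> 0" using integral_bump_pos by (simp add: J_def)
  ultimately show ?thesis by (simp only: mult_eq_0_iff simp_thms)
qed


subsection \<open>Branches of the inverse of a Blaschke product\<close>

text \<open>The right-hand side is zero for \<open>z\<close> on the circle and positive when both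
  points lie in the disc, which settles the modulus of a Blaschke factor in both cases.\<close>

lemma norm_blaschke_factor:
  fixes a z :: complex
  shows "(norm (1 - cnj a * z))\<^sup>2 - (norm (z - a))\<^sup>2 = (1 - (norm a)\<^sup>2) * (1 - (norm z)\<^sup>2)"
  by (simp add: cmod_power2) (simp add: power2_eq_square algebra_simps)

lemma blaschke_denominator_nonzero:
  fixes a z :: complex
  assumes "norm a * norm z < 1"
  shows "1 - cnj a * z \<noteq> 0"
proof
  assume "1 - cnj a * z = 0"
  then have "norm (cnj a * z) = 1" by (simp flip: eq_iff_diff_eq_0)
  then show False using assms by (simp add: norm_mult)
qed

locale blaschke_product =
  fixes a :: "'n::finite \<Rightarrow> complex" and \<phi> :: "complex \<Rightarrow> complex"
  assumes zeros_in_disc: "\<And>j. a j \<in> ball 0 1" and \<phi>_def: "\<phi> = blaschke a"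
begin

text \<open>The poles are the zeros reflected in the circle. With \<open>m\<close> the largest
  modulus of a zero, the radius \<open>R = 2 / (1 + m)\<close> satisfies both \<open>R > 1\<close>
  and \<open>m * R < 1\<close>. The margin beyond the circle yields continuity on the closed disc
  and finiteness of the critical set.\<close>

lemma holomorphic_extension:
  obtains R where "R > 1" "\<phi> holomorphic_on ball 0 R"
proof -
  define m where "m = Max (range (\<lambda>j. norm (a j)))"
  have "m \<in> range (\<lambda>j. norm (a j))" unfolding m_def by (rule Max_in) auto
  then have m: "0 \<le> m" "m < 1" using zeros_in_disc by (auto simp: dist_norm)
  have le: "norm (a j) \<le> m" for j unfolding m_def by (rule Max_ge) auto
  have "\<phi> holomorphic_on ball 0 (2 / (1 + m))"
    unfolding \<phi>_def blaschke_def
  proof (intro holomorphic_intros blaschke_denominator_nonzero)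
    fix j and z :: complex assume z: "z \<in> ball 0 (2 / (1 + m))"
    have "norm (a j) * norm z \<le> m * norm z" using le by (intro mult_right_mono) auto
    also have "\<dots> \<le> m * (2 / (1 + m))" using z m by (intro mult_left_mono) auto
    also have "\<dots> < 1" using m by (simp add: field_simps)
    finally show "norm (a j) * norm z < 1" .
  qed
  moreover have "2 / (1 + m) > 1" using m by (simp add: field_simps)
  ultimately show ?thesis using that by blast
qed

lemma \<phi>_hol: "\<phi> holomorphic_on ball 0 1"
  by (rule holomorphic_extension) (auto elim: holomorphic_on_subset)

lemma \<phi>_cont: "continuous_on (cball 0 1) \<phi>"
proof -
  obtain R where "R > 1" "\<phi> holomorphic_on ball 0 R" by (rule holomorphic_extension)
  then show ?thesis
    by (intro continuous_on_subset[OF holomorphic_on_imp_continuous_on[of \<phi> "ball 0 R"]]) auto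
qed

lemma \<phi>_m: "\<phi> \<in> borel_measurable borel"
  unfolding \<phi>_def blaschke_def
  by (intro borel_measurable_prod borel_measurable_divide borel_measurable_continuous_onI continuous_intros)

lemma \<phi>_sphere: "norm z = 1 \<Longrightarrow> norm (\<phi> z) = 1"
proof -
  assume z: "norm z = 1"
  have "norm ((z - a j) / (1 - cnj (a j) * z)) = 1" for j
  proof -
    have "1 - cnj (a j) * z \<noteq> 0"
      using zeros_in_disc[of j] z by (intro blaschke_denominator_nonzero) simp
    moreover have "(norm (z - a j))\<^sup>2 = (norm (1 - cnj (a j) * z))\<^sup>2"
      using norm_blaschke_factor[of "a j" z] z by simp
    then have "norm (z - a j) = norm (1 - cnj (a j) * z)" by simp
    ultimately show ?thesis by (simp add: norm_divide)
  qed
  then show "norm (\<phi> z) = 1" unfolding \<phi>_def blaschke_def by (simp add: prod_norm[symmetric])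
qed

lemma \<phi>_ball: "z \<in> ball 0 1 \<Longrightarrow> norm (\<phi> z) < 1"
proof -
  assume z: "z \<in> ball 0 1"
  have lt: "norm ((z - a j) / (1 - cnj (a j) * z)) < 1" for j
  proof -
    have "norm (a j) * norm z < 1 * 1"
      using zeros_in_disc[of j] z by (intro mult_strict_mono') auto
    then have nz: "1 - cnj (a j) * z \<noteq> 0" by (intro blaschke_denominator_nonzero) simp
    have "(norm (a j))\<^sup>2 < 1" "(norm z)\<^sup>2 < 1"
      using zeros_in_disc[of j] z by (simp_all add: power_less_one_iff abs_square_less_1)
    then have "0 < (1 - (norm (a j))\<^sup>2) * (1 - (norm z)\<^sup>2)" by simp
    then have "(norm (z - a j))\<^sup>2 < (norm (1 - cnj (a j) * z))\<^sup>2"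
      using norm_blaschke_factor[of "a j" z] by simp
    then have "norm (z - a j) < norm (1 - cnj (a j) * z)" by (rule power2_less_imp_less) simp
    then show ?thesis using nz by (simp add: norm_divide)
  qed
  have "(\<Prod>j\<in>UNIV. norm ((z - a j) / (1 - cnj (a j) * z))) < (\<Prod>j\<in>(UNIV::'n set). 1)"
    using lt by (intro prod_mono_strict[of undefined]) (auto intro: less_imp_le)
  then show "norm (\<phi> z) < 1" unfolding \<phi>_def blaschke_def by (simp add: prod_norm[symmetric])
qed

text \<open>A nonconstant \<open>deriv \<phi>\<close> has finitely many zeros in the closed disc, a
  compact part of the larger disc. If \<open>deriv \<phi>\<close> is constant, as for \<phi> the
  identity, the constant is nonzero, since otherwise \<phi> would be constant against
  \<open>norm (\<phi> 0) < 1 = norm (\<phi> 1)\<close>.\<close>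

lemma finite_critical_points: "finite (critical_points \<phi>)"
proof -
  obtain R where R: "R > 1" "\<phi> holomorphic_on ball 0 R" by (rule holomorphic_extension)
  have d: "deriv \<phi> holomorphic_on ball 0 R" using R by (intro holomorphic_deriv) auto
  have sub: "critical_points \<phi> \<subseteq> {z \<in> cball 0 1. deriv \<phi> z = 0}" by (auto simp: critical_points_def)
  show ?thesis
  proof (cases "deriv \<phi> constant_on ball 0 R")
    case False
    have "finite {z \<in> cball 0 1. deriv \<phi> z = 0}"
      by (rule holomorphic_compact_finite_zeros[OF d _ _ _ _ False]) (use R in auto)
    then show ?thesis using sub finite_subset by blast
  next
    case True
    then obtain c where c: "\<And>z. z \<in> ball 0 R \<Longrightarrow> deriv \<phi> z = c" by (auto simp: constant_on_def)
    have "c \<noteq> 0"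
    proof
      assume "c = 0"
      then have "(\<phi> has_field_derivative 0) (at z)" if "z \<in> ball 0 R" for z
        using holomorphic_derivI[OF R(2) _ that] c[OF that] by simp
      then have "\<phi> constant_on ball 0 R" by (rule has_field_derivative_0_imp_constant_on) auto
      then have "\<phi> 0 = \<phi> 1" using R by (auto simp: constant_on_def)
      then show False using \<phi>_ball[of 0] \<phi>_sphere[of 1] by simp
    qed
    then have "critical_points \<phi> = {}" using c R by (auto simp: critical_points_def)
    then show ?thesis by simp
  qed
qed

lemma open_regular_set: "open (regular_set \<phi>)"
proof -
  have "regular_set \<phi> = ball 0 1 \<inter> \<phi> -` (- \<phi> ` critical_points \<phi>)"
    by (auto simp: regular_set_def exceptional_set_def)
  also have "open \<dots>"
    using finite_critical_points
    by (intro continuous_open_preimage holomorphic_on_imp_continuous_on[OF \<phi>_hol])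
      (auto intro!: finite_imp_closed)
  finally show ?thesis .
qed

text \<open>The exceptional set is a union of whole fibres, so regularity depends only on the value
  of \<phi>.\<close>

lemma regular_fiber:
  assumes "z \<in> regular_set \<phi>" "w \<in> ball 0 1" "\<phi> w = \<phi> z"
  shows "w \<in> regular_set \<phi>" "deriv \<phi> w \<noteq> 0"
  using assms by (auto simp: regular_set_def exceptional_set_def critical_points_def image_iff)

end

text \<open>The coincidence sets \<open>A m\<close> are closed, pairwise disjoint and finite in
  number, and they cover \<open>S\<close>. Each is therefore the complement of a closed set as well,
  and connectedness leaves one of them.\<close>

lemma connected_unique_branch:
  fixes f :: "'i::finite \<Rightarrow> 'a::metric_space \<Rightarrow> 'b::real_normed_vector"
  assumes S: "connected S" "S \<noteq> {}" and h: "continuous_on S h" and f: "\<And>m. continuous_on S (f m)"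
    and ne: "\<And>z m m'. z \<in> S \<Longrightarrow> m \<noteq> m' \<Longrightarrow> f m z \<noteq> f m' z"
    and cov: "\<And>z. z \<in> S \<Longrightarrow> \<exists>m. h z = f m z"
  shows "\<exists>m. \<forall>z\<in>S. h z = f m z"
proof -
  define A where "A = (\<lambda>m. {z \<in> S. h z = f m z})"
  have cl: "closedin (top_of_set S) (A m)" for m
  proof -
    have "closedin (top_of_set S) {z \<in> S. h z - f m z = 0}"
      by (intro continuous_closedin_preimage_constant continuous_on_diff h f)
    then show ?thesis by (simp add: A_def)
  qed
  have op: "openin (top_of_set S) (A m)" for m
  proof -
    have "A m = S - (\<Union>m'\<in>-{m}. A m')"
    proof (intro equalityI subsetI)
      show "x \<in> S - (\<Union>m'\<in>-{m}. A m')" if "x \<in> A m" for x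
        using that ne[of x] unfolding A_def by fastforce
      show "x \<in> A m" if x: "x \<in> S - (\<Union>m'\<in>-{m}. A m')" for x
      proof -
        obtain m' where "h x = f m' x" using cov x by blast
        with x show ?thesis unfolding A_def by (cases "m' = m") auto
      qed
    qed
    moreover have "closedin (top_of_set S) (\<Union>m'\<in>-{m}. A m')"
      using cl by (intro closedin_Union) auto
    ultimately show ?thesis by (simp add: openin_diff)
  qed
  obtain z where "z \<in> S" using S by auto
  with cov obtain m where "h z = f m z" by blast
  then have "A m \<noteq> {}" using \<open>z \<in> S\<close> by (auto simp: A_def)
  then have "A m = S" using S(1) cl op unfolding connected_clopen by blast
  then show ?thesis unfolding A_def by blast
qed

section \<open>Local inverses continued to the cut domain and their permutations\<close>

locale blaschke_orientation = blaschke_product a \<phi>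
  for a :: "'n::finite \<Rightarrow> complex" and \<phi> :: "complex \<Rightarrow> complex" +
  fixes U :: "complex set" and \<gamma> :: "real \<Rightarrow> complex" and e :: 'n and \<rho> :: "'n \<Rightarrow> complex \<Rightarrow> complex"
  assumes small: "small_invertible \<phi> U" and orient: "orientation \<phi> U \<gamma> e \<rho>"
begin

definition cut_domain :: "complex set" where "cut_domain = regular_set \<phi> - path_image \<gamma>"

lemma U_ball: "open U" "connected U" "U \<noteq> {}" "U \<subseteq> regular_set \<phi>"
  using small by (auto simp: small_invertible_def)

lemma \<rho>_complete: "complete_collection \<phi> U UNIV \<rho>"
  and \<rho>_e: "z \<in> U \<Longrightarrow> \<rho> e z = z"
  and cut: "cut_curve \<phi> \<gamma>"
  and path_disjoint: "z \<in> U \<Longrightarrow> \<rho> j z \<notin> path_image \<gamma>"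
  and \<rho>_hol: "\<rho> j holomorphic_on cut_domain"
  using orient by (auto simp: orientation_def cut_domain_def)

lemma \<rho>_U: assumes "z \<in> U" shows "\<rho> j z \<in> ball 0 1" "\<phi> (\<rho> j z) = \<phi> z"
  using \<rho>_complete assms
  by (auto simp only: complete_collection_def local_inverse_def)

lemma fiber_U: assumes "z \<in> U" shows "{w \<in> ball 0 1. \<phi> w = \<phi> z} = range (\<lambda>j. \<rho> j z)" "inj (\<lambda>j. \<rho> j z)"
proof -
  have *: "\<phi> -` {\<phi> z} \<inter> ball 0 1 \<subseteq> range (\<lambda>j. \<rho> j z)" "\<And>i j. i \<noteq> j \<Longrightarrow> \<rho> i z \<noteq> \<rho> j z"
    using \<rho>_complete assms by (simp_all add: complete_collection_def)
  show "{w \<in> ball 0 1. \<phi> w = \<phi> z} = range (\<lambda>j. \<rho> j z)"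
    using *(1) \<rho>_U[OF assms] by blast
  show "inj (\<lambda>j. \<rho> j z)" using *(2) by (meson injI)
qed

lemma \<rho>_U_cut_domain: "z \<in> U \<Longrightarrow> \<rho> j z \<in> cut_domain"
  using regular_fiber(1)[of z "\<rho> j z"] \<rho>_U[of z j] U_ball path_disjoint[of z j] by (auto simp: cut_domain_def)

lemma U_sub_cut_domain: "U \<subseteq> cut_domain"
  using \<rho>_U_cut_domain[of _ e] \<rho>_e by fastforce

lemma cut_domain: shows "open cut_domain" "connected cut_domain" "cut_domain \<subseteq> regular_set \<phi>" "cut_domain \<subseteq> ball 0 1"
proof -
  show "open cut_domain" unfolding cut_domain_def
    using open_regular_set cut by (intro open_Diff closed_path_image) (auto simp: cut_curve_def)
  show "connected cut_domain" unfolding cut_domain_def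
    using cut by (intro simply_connected_imp_connected) (auto simp: cut_curve_def)
qed (auto simp: cut_domain_def regular_set_def)

lemma continuous_on_\<rho>: "continuous_on cut_domain (\<rho> j)"
  by (rule holomorphic_on_imp_continuous_on[OF \<rho>_hol])

text \<open>The orientation gives holomorphy of \<open>\<rho> j\<close> on the cut domain but
  controls its values only over \<open>U\<close>. Until these are known to stay in the disc,
  \<open>\<phi> (\<rho> j z)\<close> need not be holomorphic and the identity theorem cannot be
  applied globally. Hence a clopen argument on the set of points near which both claims
  hold.\<close>

lemma \<rho>_cut_domain: assumes "z \<in> cut_domain" shows "\<rho> j z \<in> ball 0 1" "\<phi> (\<rho> j z) = \<phi> z"
proof -
  define A where "A = {z \<in> cut_domain. \<exists>r>0. ball z r \<subseteq> cut_domain \<and> (\<forall>w\<in>ball z r. \<rho> j w \<in> ball 0 1 \<and> \<phi> (\<rho> j w) = \<phi> w)}"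
  have AD: "A \<subseteq> cut_domain" by (auto simp: A_def)
  have Aval: "\<rho> j z \<in> ball 0 1" "\<phi> (\<rho> j z) = \<phi> z" if "z \<in> A" for z
    using that by (auto simp: A_def)
  have "open A"
    unfolding open_contains_ball
  proof (rule ballI)
    fix z assume "z \<in> A"
    then obtain r where r: "r > 0" "ball z r \<subseteq> cut_domain" "\<And>w. w \<in> ball z r \<Longrightarrow> \<rho> j w \<in> ball 0 1 \<and> \<phi> (\<rho> j w) = \<phi> w"
      unfolding A_def by blast
    have "ball z r \<subseteq> A"
    proof
      fix w assume w: "w \<in> ball z r"
      then obtain s where "s > 0" "ball w s \<subseteq> ball z r" using open_ball by (meson openE)
      then show "w \<in> A" using r w unfolding A_def by blast
    qed
    then show "\<exists>r>0. ball z r \<subseteq> A" using r(1) by blast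
  qed
  have "closedin (top_of_set cut_domain) A"
    unfolding closedin_limpt
  proof (intro conjI AD allI impI)
    fix x assume "x islimpt A \<and> x \<in> cut_domain"
    then have x: "x islimpt A" "x \<in> cut_domain" by auto
    then obtain s where s: "\<And>n. s n \<in> A" "s \<longlonglongrightarrow> x"
      unfolding islimpt_sequential by auto
    have "isCont (\<rho> j) x" using continuous_on_\<rho> x cut_domain(1) by (simp add: continuous_on_eq_continuous_at)
    then have lim: "(\<lambda>n. \<rho> j (s n)) \<longlonglongrightarrow> \<rho> j x" using s(2) by (rule isCont_tendsto_compose)
    have in1: "\<rho> j (s n) \<in> cball 0 1" for n using Aval(1)[OF s(1)[of n]] by simp
    have cb: "\<rho> j x \<in> cball 0 1"
      by (rule closed_sequentially[OF closed_cball _ lim]) (use in1 in auto)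
    have "(\<lambda>n. \<phi> (\<rho> j (s n))) \<longlonglongrightarrow> \<phi> (\<rho> j x)"
      by (rule continuous_on_tendsto_compose[OF \<phi>_cont lim cb]) (use in1 in auto)
    moreover have "(\<lambda>n. \<phi> (\<rho> j (s n))) \<longlonglongrightarrow> \<phi> x"
    proof -
      have "isCont \<phi> x"
        using holomorphic_on_imp_continuous_on[OF \<phi>_hol] x cut_domain by (auto simp: continuous_on_eq_continuous_at)
      then have "(\<lambda>n. \<phi> (s n)) \<longlonglongrightarrow> \<phi> x" using s(2) by (rule isCont_tendsto_compose)
      then show ?thesis using Aval(2)[OF s(1)] by simp
    qed
    ultimately have eq: "\<phi> (\<rho> j x) = \<phi> x" by (rule LIMSEQ_unique)
    \<comment> \<open>A limit of values in the disc could reach the circle; but \<phi> has modulus 1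
      there, while \<open>norm (\<phi> x) < 1\<close>.\<close>
    have inb: "\<rho> j x \<in> ball 0 1"
      using cb eq \<phi>_sphere[of "\<rho> j x"] \<phi>_ball[of x] x cut_domain(4) by force
    have "open (cut_domain \<inter> \<rho> j -` ball 0 1)"
      by (rule continuous_open_preimage[OF continuous_on_\<rho> cut_domain(1)]) auto
    then obtain r where r: "r > 0" "ball x r \<subseteq> cut_domain \<inter> \<rho> j -` ball 0 1"
      using x inb by (meson IntI openE vimageI)
    obtain y where y: "y \<in> A" "y \<in> ball x r"
      using x(1) r(1) unfolding islimpt_approachable by (auto simp: dist_commute)
    \<comment> \<open>Now \<open>\<rho> j\<close> maps this small disc into the unit disc, so both
      sides are holomorphic on it, and they agree on its nonempty open part inside
      \<open>A\<close>.\<close>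
    have "\<phi> (\<rho> j w) = \<phi> w" if "w \<in> ball x r" for w
    proof (rule analytic_continuation_open[where s = "A \<inter> ball x r" and s' = "ball x r"
          and f = "\<lambda>w. \<phi> (\<rho> j w)" and g = \<phi>])
      show "(\<lambda>w. \<phi> (\<rho> j w)) holomorphic_on ball x r"
        using r holomorphic_on_compose_gen[OF holomorphic_on_subset[OF \<rho>_hol] \<phi>_hol, of "ball x r" j]
        by (auto simp: o_def)
      show "\<phi> holomorphic_on ball x r"
        using r cut_domain(4) by (intro holomorphic_on_subset[OF \<phi>_hol]) auto
    qed (use y \<open>open A\<close> Aval that in auto)
    moreover have "\<rho> j w \<in> ball 0 1" if "w \<in> ball x r" for w using r(2) that by blast
    moreover have "ball x r \<subseteq> cut_domain" using r(2) by blast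
    ultimately show "x \<in> A" using x(2) r(1) unfolding A_def by blast
  qed
  moreover have "openin (top_of_set cut_domain) A" using \<open>open A\<close> AD by (simp add: open_subset)
  moreover have "A \<noteq> {}"
  proof -
    obtain z where z: "z \<in> U" using U_ball by auto
    then obtain r where "r > 0" "ball z r \<subseteq> U" using U_ball(1) openE by blast
    then have "z \<in> A" using z U_sub_cut_domain \<rho>_U unfolding A_def by blast
    then show ?thesis by auto
  qed
  ultimately have "A = cut_domain" using cut_domain(2) unfolding connected_clopen by blast
  then show "\<rho> j z \<in> ball 0 1" "\<phi> (\<rho> j z) = \<phi> z" using Aval assms by auto
qed

text \<open>Near a meeting point of two branches \<phi> is injective, so
  \<open>\<phi> (\<rho> i w) = \<phi> w = \<phi> (\<rho> j w)\<close> makes the branches agree on an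
  open set, hence everywhere. This contradicts their distinctness on \<open>U\<close>.\<close>

lemma \<rho>_distinct:
  assumes z: "z \<in> cut_domain" and "i \<noteq> j" shows "\<rho> i z \<noteq> \<rho> j z"
proof
  assume eq: "\<rho> i z = \<rho> j z"
  define p where "p = \<rho> i z"
  have "deriv \<phi> p \<noteq> 0"
    using regular_fiber(2)[of z p] z cut_domain(3) \<rho>_cut_domain[OF z, of i] by (auto simp: p_def)
  then obtain r where r: "r > 0" "ball p r \<subseteq> ball 0 1" "inj_on \<phi> (ball p r)"
    using has_complex_derivative_locally_injective[OF \<phi>_hol _ open_ball, of p] \<rho>_cut_domain[OF z, of i]
    by (auto simp: p_def)
  define T where "T = (cut_domain \<inter> \<rho> i -` ball p r) \<inter> (cut_domain \<inter> \<rho> j -` ball p r)"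
  have T: "open T"
    unfolding T_def by (intro open_Int continuous_open_preimage[OF continuous_on_\<rho> cut_domain(1)] open_ball)
  have zT: "z \<in> T" using z eq r by (auto simp: T_def p_def)
  have TT: "\<rho> i w = \<rho> j w" if "w \<in> T" for w
    using that \<rho>_cut_domain[of w] inj_onD[OF r(3), of "\<rho> i w" "\<rho> j w"] by (auto simp: T_def)
  obtain u where u: "u \<in> U" using U_ball by auto
  have "\<rho> i u = \<rho> j u"
    by (rule analytic_continuation_open[OF T cut_domain(1) _ cut_domain(2) _ \<rho>_hol[of i] \<rho>_hol[of j]])
      (use zT TT u U_sub_cut_domain in \<open>auto simp: T_def\<close>)
  then show False using fiber_U(2)[OF u] \<open>i \<noteq> j\<close> by (auto simp: inj_on_def)
qed

abbreviation \<pi> where "\<pi> \<equiv> orientation_perm \<rho> U"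

text \<open>At each point \<open>\<rho> k (\<rho> i z)\<close> lies in the fibre of \<open>z\<close>
  and so equals some \<open>\<rho> m z\<close>; connectedness of \<open>U\<close> makes
  \<open>m\<close> constant, and distinctness of the branches makes it unique, as the
  \<open>THE\<close> requires.\<close>

lemma \<pi>: "z \<in> U \<Longrightarrow> \<rho> k (\<rho> i z) = \<rho> (\<pi> i k) z"
proof -
  have "\<exists>m. \<forall>z\<in>U. \<rho> k (\<rho> i z) = \<rho> m z"
  proof (rule connected_unique_branch[OF U_ball(2,3)])
    show "continuous_on U (\<lambda>z. \<rho> k (\<rho> i z))"
      by (rule continuous_on_compose2[OF continuous_on_\<rho> continuous_on_subset[OF continuous_on_\<rho> U_sub_cut_domain]])
        (use \<rho>_U_cut_domain in auto)
    show "continuous_on U (\<rho> m)" for m by (rule continuous_on_subset[OF continuous_on_\<rho> U_sub_cut_domain])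
    show "\<rho> m z \<noteq> \<rho> m' z" if "z \<in> U" "m \<noteq> m'" for z m m'
      using \<rho>_distinct that U_sub_cut_domain by blast
    show "\<exists>m. \<rho> k (\<rho> i z) = \<rho> m z" if "z \<in> U" for z
      using fiber_U(1)[OF that] \<rho>_cut_domain[OF \<rho>_U_cut_domain[OF that], of k i] \<rho>_U(2)[OF that, of i] by auto
  qed
  then obtain m where m: "\<forall>z\<in>U. \<rho> k (\<rho> i z) = \<rho> m z" by blast
  have "\<pi> i k = m"
    unfolding orientation_perm_def
  proof (rule the_equality)
    fix m' assume m': "\<forall>z\<in>U. \<rho> k (\<rho> i z) = \<rho> m' z"
    obtain u where u: "u \<in> U" using U_ball by auto
    then show "m' = m" using m m' \<rho>_distinct[of u m m'] U_sub_cut_domain by auto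
  qed (rule m)
  then show "z \<in> U \<Longrightarrow> \<rho> k (\<rho> i z) = \<rho> (\<pi> i k) z" using m by blast
qed

text \<open>Injectivity is distinctness of the branches at \<open>\<rho> i u\<close>, a point of the
  cut domain; the index type is finite.\<close>

lemma bij_\<pi>: "bij (\<pi> i)"
proof -
  obtain u where u: "u \<in> U" using U_ball by auto
  have "inj (\<pi> i)"
  proof (rule injI)
    fix k l assume "\<pi> i k = \<pi> i l"
    then have "\<rho> k (\<rho> i u) = \<rho> l (\<rho> i u)" using \<pi>[OF u] by simp
    then show "k = l" using \<rho>_distinct[OF \<rho>_U_cut_domain[OF u]] by blast
  qed
  then show ?thesis by (simp add: bij_def finite_UNIV_inj_surj)
qed

lemma \<rho>_deriv: "z \<in> cut_domain \<Longrightarrow> (\<rho> j has_field_derivative deriv (\<rho> j) z) (at z)"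
  by (rule holomorphic_derivI[OF \<rho>_hol cut_domain(1)])

lemma deriv_\<pi>: assumes "z \<in> U" shows "deriv (\<rho> k) (\<rho> i z) * deriv (\<rho> i) z = deriv (\<rho> (\<pi> i k)) z"
proof -
  have "((\<lambda>z. \<rho> k (\<rho> i z)) has_field_derivative deriv (\<rho> k) (\<rho> i z) * deriv (\<rho> i) z) (at z)"
    using assms U_sub_cut_domain by (intro DERIV_chain2[OF \<rho>_deriv \<rho>_deriv] \<rho>_U_cut_domain) auto
  then have "(\<rho> (\<pi> i k) has_field_derivative deriv (\<rho> k) (\<rho> i z) * deriv (\<rho> i) z) (at z)"
    by (rule has_field_derivative_transform_within_open[OF _ U_ball(1) assms]) (rule \<pi>)
  then show ?thesis by (simp add: DERIV_imp_deriv)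
qed

lemma deriv_fiber: assumes "z \<in> U" shows "deriv \<phi> (\<rho> k z) * deriv (\<rho> k) z = deriv \<phi> z" "deriv \<phi> z \<noteq> 0"
proof -
  have d: "(\<phi> has_field_derivative deriv \<phi> w) (at w)" if "w \<in> ball 0 1" for w
    using holomorphic_derivI[OF \<phi>_hol _ that] by simp
  have "((\<lambda>z. \<phi> (\<rho> k z)) has_field_derivative deriv \<phi> (\<rho> k z) * deriv (\<rho> k) z) (at z)"
    using assms U_sub_cut_domain by (intro DERIV_chain2[OF d \<rho>_deriv] \<rho>_U) auto
  then have "(\<phi> has_field_derivative deriv \<phi> (\<rho> k z) * deriv (\<rho> k) z) (at z)"
    by (rule has_field_derivative_transform_within_open[OF _ U_ball(1) assms]) (rule \<rho>_U)
  then show "deriv \<phi> (\<rho> k z) * deriv (\<rho> k) z = deriv \<phi> z" by (simp add: DERIV_imp_deriv)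
  show "deriv \<phi> z \<noteq> 0" using assms U_ball(4) regular_fiber(2)[of z z] cut_domain U_sub_cut_domain by blast
qed

lemma deriv_\<rho>_nonzero: "z \<in> U \<Longrightarrow> deriv (\<rho> k) z \<noteq> 0"
  using deriv_fiber(1)[of z k] deriv_fiber(2)[of z] by auto

end


subsection \<open>Unitary operators commuting with a Blaschke product\<close>

lemma bergman_space_entire:
  assumes "p holomorphic_on UNIV"
  shows "(\<lambda>z. p z * indicator (ball 0 1) z) \<in> bergman_space"
proof -
  have "compact (p ` cball 0 1)"
    using assms by (intro compact_continuous_image holomorphic_on_imp_continuous_on)
      (auto intro: holomorphic_on_subset)
  from compact_imp_bounded[OF this] obtain B where "\<forall>x\<in>p ` cball 0 1. norm x \<le> B"
    unfolding bounded_iff by blast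
  then show ?thesis
    by (intro bergman_space_bounded[where B = B] holomorphic_on_subset[OF assms]) auto
qed

text \<open>The pairing of \<open>s\<close> with its own value at \<open>w\<close> is a holomorphic function bounded by 1 that attains
  1 at \<open>w\<close>.\<close>

lemma holomorphic_unit_vector_constant:
  fixes s :: "'k::finite \<Rightarrow> complex \<Rightarrow> complex"
  assumes hol: "\<And>k. s k holomorphic_on S" and S: "open S" "connected S"
    and unit: "\<And>z. z \<in> S \<Longrightarrow> (\<Sum>k\<in>UNIV. (norm (s k z))\<^sup>2) = 1"
    and z: "z \<in> S" and w: "w \<in> S"
  shows "s k z = s k w"
proof -
  define g where "g = (\<lambda>z. \<Sum>k\<in>UNIV. cnj (s k w) * s k z)"
  \<comment> \<open>For unit vectors the squared distance is 2 minus twice the real part of their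
    pairing, so a pairing equal to 1 forces equality.\<close>
  have key: "(\<Sum>k\<in>UNIV. (norm (s k z - s k w))\<^sup>2) = 2 - 2 * Re (g z)" if "z \<in> S" for z
  proof -
    have "(norm (x - y))\<^sup>2 = (norm x)\<^sup>2 + (norm y)\<^sup>2 - 2 * Re (cnj y * x)" for x y :: complex
      by (simp add: cmod_power2 power2_diff)
    then show ?thesis
      using unit[OF that] unit[OF w] by (simp add: g_def sum.distrib sum_subtractf sum_distrib_left)
  qed
  have le: "norm (g z) \<le> 1" if "z \<in> S" for z
  proof -
    have "norm (g z) \<le> (\<Sum>k\<in>UNIV. norm (s k w) * norm (s k z))"
      unfolding g_def by (rule order_trans[OF norm_sum]) (simp add: norm_mult)
    also have "\<dots> \<le> (\<Sum>k\<in>UNIV. ((norm (s k w))\<^sup>2 + (norm (s k z))\<^sup>2) / 2)"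
    proof (rule sum_mono)
      show "norm (s k w) * norm (s k z) \<le> ((norm (s k w))\<^sup>2 + (norm (s k z))\<^sup>2) / 2" for k
        using sum_squares_bound[of "norm (s k w)" "norm (s k z)"] by simp
    qed
    also have "\<dots> = 1" using unit[OF that] unit[OF w] by (simp add: sum.distrib flip: sum_divide_distrib)
    finally show ?thesis .
  qed
  have "g w = of_real (\<Sum>k\<in>UNIV. (norm (s k w))\<^sup>2)"
    unfolding g_def of_real_sum by (rule sum.cong) (simp_all add: complex_norm_square mult.commute del: of_real_power)
  then have gw: "g w = 1" using unit[OF w] by simp
  have "g holomorphic_on S" unfolding g_def by (intro holomorphic_intros hol)
  then have "g constant_on S"
    by (rule maximum_modulus_principle[OF _ S S(1) order_refl w]) (use le gw in simp)
  then have "g z = 1" using gw z w by (auto simp: constant_on_def)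
  then have "(\<Sum>k\<in>UNIV. (norm (s k z - s k w))\<^sup>2) = 0" using key[OF z] by simp
  then have "(norm (s k z - s k w))\<^sup>2 = 0" by (simp add: sum_nonneg_eq_0_iff)
  then show ?thesis by simp
qed

lemma unitary_matrixI:
  fixes M :: "complex^'k^'k"
  assumes "\<And>k l. (\<Sum>i\<in>UNIV. cnj (M $ i $ l) * M $ i $ k) = (if k = l then 1 else 0)"
  shows "unitary_matrix M"
proof -
  have "(\<chi> i k. cnj (M $ k $ i)) ** M = mat 1"
    using assms by (auto simp: matrix_matrix_mult_def mat_def vec_eq_iff)
  then show ?thesis unfolding unitary_matrix_def by (simp add: matrix_left_right_inverse)
qed

lemma unitary_matrix_row:
  fixes M :: "complex^'k^'k"
  assumes "unitary_matrix M"
  shows "(\<Sum>k\<in>UNIV. (norm (M $ i $ k))\<^sup>2) = 1"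
proof -
  have "(M ** (\<chi> i k. cnj (M $ k $ i))) $ i $ i = mat 1 $ i $ i"
    using assms by (simp add: unitary_matrix_def)
  then have "(\<Sum>k\<in>UNIV. M $ i $ k * cnj (M $ i $ k)) = 1"
    by (simp add: matrix_matrix_mult_def mat_def)
  then have "complex_of_real (\<Sum>k\<in>UNIV. (norm (M $ i $ k))\<^sup>2) = 1"
    by (simp add: complex_norm_square del: of_real_power)
  then show ?thesis by (simp only: of_real_eq_1_iff)
qed

lemma unitary_matrix_cnj:
  assumes "unitary_matrix M"
  shows "unitary_matrix (\<chi> i k. cnj (M $ i $ k))"
proof (rule unitary_matrixI)
  fix k l
  have "((\<chi> i k. cnj (M $ k $ i)) ** M) $ k $ l = mat 1 $ k $ l"
    using assms by (simp add: unitary_matrix_def)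
  then show "(\<Sum>i\<in>UNIV. cnj ((\<chi> i k. cnj (M $ i $ k)) $ i $ l) * (\<chi> i k. cnj (M $ i $ k)) $ i $ k) = (if k = l then 1 else 0)"
    by (simp add: matrix_matrix_mult_def mat_def mult.commute)
qed

section \<open>Action of the unitary operator on the values over a fibre\<close>

locale blaschke_unitary = blaschke_orientation a \<phi> U \<gamma> e \<rho>
  for a :: "'n::finite \<Rightarrow> complex" and \<phi> U \<gamma> and e :: 'n and \<rho> +
  fixes W :: "(complex \<Rightarrow> complex) \<Rightarrow> complex \<Rightarrow> complex"
  assumes W_unitary: "bergman_unitary W"
    and W_commute: "\<And>f. f \<in> bergman_space \<Longrightarrow> W (mult_operator \<phi> f) = mult_operator \<phi> (W f)"
begin

lemma W_in: "f \<in> bergman_space \<Longrightarrow> W f \<in> bergman_space"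
  and W_add: "f \<in> bergman_space \<Longrightarrow> g \<in> bergman_space \<Longrightarrow> W (\<lambda>z. f z + g z) = (\<lambda>z. W f z + W g z)"
  and W_cmult: "f \<in> bergman_space \<Longrightarrow> W (\<lambda>z. c * f z) = (\<lambda>z. c * W f z)"
  and W_inner: "f \<in> bergman_space \<Longrightarrow> g \<in> bergman_space \<Longrightarrow> bergman_inner (W f) (W g) = bergman_inner f g"
  using W_unitary by (auto simp: bergman_unitary_def bergman_linear_def)

lemma W_sum:
  assumes "\<And>i. i \<in> I \<Longrightarrow> f i \<in> bergman_space"
  shows "W (\<lambda>z. \<Sum>i\<in>I. c i * f i z) = (\<lambda>z. \<Sum>i\<in>I. c i * W (f i) z)"
  using assms
proof (induction I rule: infinite_finite_induct)
  case (insert i I)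
  have "W (\<lambda>z. c i * f i z + (\<Sum>i\<in>I. c i * f i z)) = (\<lambda>z. W (\<lambda>z. c i * f i z) z + W (\<lambda>z. \<Sum>i\<in>I. c i * f i z) z)"
    by (intro W_add bergman_space_cmult bergman_space_sum) (use insert in auto)
  then show ?case using insert by (simp add: W_cmult)
qed (use W_cmult[OF bergman_space_zero, of 0] in simp_all)

lemma bergman_space_\<phi>_power: "f \<in> bergman_space \<Longrightarrow> (\<lambda>z. \<phi> z ^ k * f z) \<in> bergman_space"
  by (rule bergman_space_mult[where B = 1])
    (auto intro!: holomorphic_intros \<phi>_hol power_le_one less_imp_le[OF \<phi>_ball] simp: norm_power)

lemma W_\<phi>_power: "f \<in> bergman_space \<Longrightarrow> W (\<lambda>z. \<phi> z ^ k * f z) = (\<lambda>z. \<phi> z ^ k * W f z)"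
proof (induction k)
  case (Suc k)
  have "W (mult_operator \<phi> (\<lambda>z. \<phi> z ^ k * f z)) = mult_operator \<phi> (W (\<lambda>z. \<phi> z ^ k * f z))"
    by (intro W_commute bergman_space_\<phi>_power Suc)
  then show ?case using Suc by (simp add: mult_operator_def mult.assoc)
qed simp

text \<open>The branches of \<open>f\<close>, weighted so that the sum over a fibre of \<open>\<phi>\<close> becomes an inner product
  of vectors.\<close>

definition branch_vec :: "(complex \<Rightarrow> complex) \<Rightarrow> complex \<Rightarrow> 'n \<Rightarrow> complex" where
  "branch_vec f \<alpha> i = deriv (\<rho> i) \<alpha> * f (\<rho> i \<alpha>)"

text \<open>The monomial \<open>\<phi> ^ k * cnj \<phi> ^ l\<close> splits into a power of \<phi> on
  each argument of the inner product. Each moment is thus a difference of two inner products that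
  \<open>W\<close> preserves. The fibre identity comes with weights
  \<open>1 / |deriv \<phi> (\<rho> i \<alpha>)|^2\<close>, which by the chain rule equal
  \<open>|deriv (\<rho> i) \<alpha>|^2\<close> up to a factor common to the fibre.\<close>

lemma branch_vec_inner:
  assumes f: "f \<in> bergman_space" and g: "g \<in> bergman_space" and \<alpha>: "\<alpha> \<in> U"
  shows "(\<Sum>i\<in>UNIV. branch_vec (W f) \<alpha> i * cnj (branch_vec (W g) \<alpha> i)) = (\<Sum>i\<in>UNIV. branch_vec f \<alpha> i * cnj (branch_vec g \<alpha> i))"
proof -
  define h where "h = (\<lambda>z. W f z * cnj (W g z) - f z * cnj (g z))"
  define P where "P = {z \<in> ball 0 1. \<phi> z = \<phi> \<alpha>}"
  have P: "P = range (\<lambda>j. \<rho> j \<alpha>)" unfolding P_def by (rule fiber_U(1)[OF \<alpha>])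
  have reg: "\<alpha> \<in> regular_set \<phi>" using \<alpha> U_ball by auto
  have moments: "(\<integral>z. \<phi> z ^ k * cnj (\<phi> z) ^ l * h z \<partial>disc_area) = 0" for k l
  proof -
    let ?f = "\<lambda>z. \<phi> z ^ k * f z" and ?g = "\<lambda>z. \<phi> z ^ l * g z"
    have fg: "?f \<in> bergman_space" "?g \<in> bergman_space" using f g by (auto intro: bergman_space_\<phi>_power)
    have "(\<integral>z. \<phi> z ^ k * cnj (\<phi> z) ^ l * h z \<partial>disc_area) =
        (\<integral>z. W ?f z * cnj (W ?g z) - ?f z * cnj (?g z) \<partial>disc_area)"
      unfolding h_def W_\<phi>_power[OF f] W_\<phi>_power[OF g]
      by (rule Bochner_Integration.integral_cong) (simp_all add: algebra_simps)
    also have "\<dots> = bergman_inner (W ?f) (W ?g) - bergman_inner ?f ?g"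
      unfolding bergman_inner_def
      by (intro Bochner_Integration.integral_diff bergman_inner_integrable W_in fg)
    finally show ?thesis by (simp add: W_inner fg)
  qed
  have cont: "continuous_on (ball 0 1) f'" if "f' \<in> bergman_space" for f'
    using that by (intro holomorphic_on_imp_continuous_on bergman_space_holomorphic)
  have "(\<Sum>p\<in>P. h p / of_real ((norm (deriv \<phi> p))\<^sup>2)) = 0"
  proof (rule sum_fiber_eq_0[OF \<phi>_hol \<phi>_cont \<phi>_m \<phi>_sphere \<phi>_ball _ _ moments _ P_def])
    show "integrable disc_area h" unfolding h_def
      by (intro Bochner_Integration.integrable_diff bergman_inner_integrable W_in f g)
    show "continuous_on (ball 0 1) h" unfolding h_def
      by (intro continuous_intros cont W_in f g)
    show "norm (\<phi> \<alpha>) < 1" using \<phi>_ball[of \<alpha>] \<alpha> U_sub_cut_domain cut_domain(4) by blast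
    show "finite P" by (simp add: P)
    show "deriv \<phi> p \<noteq> 0" if "p \<in> P" for p
      using that regular_fiber(2)[OF reg] by (auto simp: P_def)
  qed
  then have "(\<Sum>i\<in>UNIV. h (\<rho> i \<alpha>) / of_real ((norm (deriv \<phi> (\<rho> i \<alpha>)))\<^sup>2)) = 0"
    unfolding P by (subst (asm) sum.reindex[OF fiber_U(2)[OF \<alpha>]]) (simp add: o_def)
  moreover have "h (\<rho> i \<alpha>) / of_real ((norm (deriv \<phi> (\<rho> i \<alpha>)))\<^sup>2) =
      (branch_vec (W f) \<alpha> i * cnj (branch_vec (W g) \<alpha> i) - branch_vec f \<alpha> i * cnj (branch_vec g \<alpha> i)) / of_real ((norm (deriv \<phi> \<alpha>))\<^sup>2)" for i
  proof -
    have d: "deriv \<phi> \<alpha> = deriv \<phi> (\<rho> i \<alpha>) * deriv (\<rho> i) \<alpha>" "deriv \<phi> \<alpha> \<noteq> 0"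
      using deriv_fiber(1)[OF \<alpha>, of i] deriv_fiber(2)[OF \<alpha>] by simp_all
    then have "deriv (\<rho> i) \<alpha> \<noteq> 0" "deriv \<phi> (\<rho> i \<alpha>) \<noteq> 0" by auto
    then show ?thesis
      unfolding d(1) branch_vec_def h_def norm_mult
      by (simp add: power_mult_distrib complex_norm_square field_simps del: of_real_power)
  qed
  ultimately have "(\<Sum>i\<in>UNIV. branch_vec (W f) \<alpha> i * cnj (branch_vec (W g) \<alpha> i) - branch_vec f \<alpha> i * cnj (branch_vec g \<alpha> i)) / of_real ((norm (deriv \<phi> \<alpha>))\<^sup>2) = 0"
    by (simp only: sum_divide_distrib)
  then show ?thesis using deriv_fiber(2)[OF \<alpha>] by (simp add: sum_subtractf)
qed

text \<open>An unnormalized Lagrange numerator on the nodes \<open>\<rho> j \<alpha>\<close>, cut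
  off outside the disc. The power \<open>z ^ m\<close> strengthens the later induction over
  \<open>K\<close>, in which expanding one factor raises \<open>m\<close> by one.\<close>

definition node_poly :: "nat \<Rightarrow> 'n set \<Rightarrow> complex \<Rightarrow> complex \<Rightarrow> complex" where
  "node_poly m K \<alpha> z = z ^ m * (\<Prod>j\<in>K. z - \<rho> j \<alpha>) * indicator (ball 0 1) z"

definition lagrange :: "'n \<Rightarrow> complex \<Rightarrow> complex \<Rightarrow> complex" where
  "lagrange k \<alpha> z = inverse (\<Prod>j\<in>-{k}. \<rho> k \<alpha> - \<rho> j \<alpha>) * node_poly 0 (-{k}) \<alpha> z"

lemma node_poly_in: "node_poly m K \<alpha> \<in> bergman_space"
  unfolding node_poly_def[abs_def] by (intro bergman_space_entire holomorphic_intros)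

lemma lagrange_in: "lagrange k \<alpha> \<in> bergman_space"
  unfolding lagrange_def[abs_def] by (intro bergman_space_cmult node_poly_in)

lemma lagrange_node:
  assumes \<alpha>: "\<alpha> \<in> U" shows "lagrange k \<alpha> (\<rho> i \<alpha>) = (if i = k then 1 else 0)"
proof (cases "i = k")
  case True
  have "(\<Prod>j\<in>-{k}. \<rho> k \<alpha> - \<rho> j \<alpha>) \<noteq> 0"
    using fiber_U(2)[OF \<alpha>] by (auto simp: inj_on_def)
  then show ?thesis using True \<rho>_U(1)[OF \<alpha>, of k] by (simp add: lagrange_def node_poly_def)
next
  case False
  then have "(\<Prod>j\<in>-{k}. \<rho> i \<alpha> - \<rho> j \<alpha>) = 0" by (intro prod_zero) auto
  then show ?thesis using False by (simp add: lagrange_def node_poly_def)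
qed

text \<open>The values of \<open>W f\<close> on a fibre depend only on those of \<open>f\<close>
  there: the difference between \<open>f\<close> and its interpolant has branch vector 0, so by
  \<open>branch_vec_inner\<close> its image has branch vector 0 too, and the weights are
  nonzero.\<close>

lemma W_lagrange:
  assumes f: "f \<in> bergman_space" and \<alpha>: "\<alpha> \<in> U"
  shows "W f (\<rho> i \<alpha>) = (\<Sum>k\<in>UNIV. f (\<rho> k \<alpha>) * W (lagrange k \<alpha>) (\<rho> i \<alpha>))"
proof -
  define g where "g = (\<lambda>z. \<Sum>k\<in>UNIV. f (\<rho> k \<alpha>) * lagrange k \<alpha> z)"
  have g: "g \<in> bergman_space" unfolding g_def by (intro bergman_space_sum bergman_space_cmult lagrange_in)
  have Wg: "W g = (\<lambda>z. \<Sum>k\<in>UNIV. f (\<rho> k \<alpha>) * W (lagrange k \<alpha>) z)"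
    unfolding g_def by (intro W_sum lagrange_in)
  define d where "d = (\<lambda>z. f z + (-1) * g z)"
  have d: "d \<in> bergman_space" unfolding d_def by (intro bergman_space_add bergman_space_cmult f g)
  have Wd: "W d = (\<lambda>z. W f z + (-1) * W g z)"
    unfolding d_def by (simp only: W_add[OF f bergman_space_cmult[OF g]] W_cmult[OF g])
  have "d (\<rho> j \<alpha>) = 0" for j
    by (simp add: d_def g_def lagrange_node[OF \<alpha>] if_distrib cong: if_cong)
  then have "(\<Sum>j\<in>UNIV. branch_vec (W d) \<alpha> j * cnj (branch_vec (W d) \<alpha> j)) = 0"
    unfolding branch_vec_inner[OF d d \<alpha>] by (simp add: branch_vec_def)
  then have "complex_of_real (\<Sum>j\<in>UNIV. (norm (branch_vec (W d) \<alpha> j))\<^sup>2) = 0"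
    by (simp add: complex_norm_square del: of_real_power)
  then have "(\<Sum>j\<in>UNIV. (norm (branch_vec (W d) \<alpha> j))\<^sup>2) = 0" by (simp only: of_real_eq_0_iff)
  then have "(norm (branch_vec (W d) \<alpha> i))\<^sup>2 = 0" by (simp add: sum_nonneg_eq_0_iff)
  then have "W d (\<rho> i \<alpha>) = 0" using deriv_\<rho>_nonzero[OF \<alpha>, of i] by (simp add: branch_vec_def)
  then show ?thesis unfolding Wd Wg by simp
qed

text \<open>Rescaled Lagrange functions have the standard basis as branch vectors, so preservation
  of the pairing reads as orthonormality of the columns of \<open>M\<close>.\<close>

lemma transfer_matrix_unitary:
  assumes \<alpha>: "\<alpha> \<in> U"
    and M: "\<And>f i. f \<in> bergman_space \<Longrightarrow> branch_vec (W f) \<alpha> i = (\<Sum>k\<in>UNIV. M $ i $ k * branch_vec f \<alpha> k)"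
  shows "unitary_matrix M"
proof (rule unitary_matrixI)
  fix k l :: 'n
  define f where "f = (\<lambda>k z. inverse (deriv (\<rho> k) \<alpha>) * lagrange k \<alpha> z)"
  have f: "f k \<in> bergman_space" for k unfolding f_def by (intro bergman_space_cmult lagrange_in)
  have Gf: "branch_vec (f k) \<alpha> j = (if j = k then 1 else 0)" for j k
    using deriv_\<rho>_nonzero[OF \<alpha>, of j]
    by (cases "j = k") (simp_all add: branch_vec_def f_def lagrange_node[OF \<alpha>])
  have GW: "branch_vec (W (f k)) \<alpha> i = M $ i $ k" for i k
    unfolding M[OF f] Gf by (simp add: if_distrib cong: if_cong)
  have "(\<Sum>i\<in>UNIV. branch_vec (f k) \<alpha> i * cnj (branch_vec (f l) \<alpha> i)) = (\<Sum>i\<in>UNIV. if i = k then (if k = l then 1 else 0) else 0)"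
    unfolding Gf by (rule sum.cong) auto
  also have "\<dots> = (if k = l then 1 else 0)" by simp
  finally show "(\<Sum>i\<in>UNIV. cnj (M $ i $ l) * M $ i $ k) = (if k = l then 1 else 0)"
    using branch_vec_inner[OF f f \<alpha>, of k l] unfolding GW by (simp add: mult.commute)
qed

text \<open>The function to which \<open>W\<close> is applied varies with \<alpha>. Expanding a
  factor \<open>z - \<rho> j \<alpha>\<close> moves its dependence on \<alpha> into the scalar
  \<open>\<rho> j \<alpha>\<close>, which passes through \<open>W\<close> by linearity; when no
  factor is left, \<open>W\<close> acts on a fixed monomial.\<close>

lemma holomorphic_W_node_poly: "finite K \<Longrightarrow> (\<lambda>\<alpha>. W (node_poly m K \<alpha>) \<alpha>) holomorphic_on U"
proof (induction K arbitrary: m rule: finite_induct)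
  case empty
  have "(\<lambda>\<alpha>. W (node_poly m {} \<alpha>) \<alpha>) = W (node_poly m {} 0)"
    by (simp add: node_poly_def[abs_def])
  moreover have "W (node_poly m {} 0) holomorphic_on U"
    using U_sub_cut_domain cut_domain(4)
    by (intro holomorphic_on_subset[OF bergman_space_holomorphic[OF W_in[OF node_poly_in]]]) auto
  ultimately show ?case by simp
next
  case (insert j K)
  have "W (node_poly m (insert j K) \<alpha>) = (\<lambda>z. W (node_poly (Suc m) K \<alpha>) z + (- \<rho> j \<alpha>) * W (node_poly m K \<alpha>) z)" for \<alpha>
  proof -
    have "node_poly m (insert j K) \<alpha> = (\<lambda>z. node_poly (Suc m) K \<alpha> z + (- \<rho> j \<alpha>) * node_poly m K \<alpha> z)"
      using insert(1,2) by (simp add: node_poly_def fun_eq_iff algebra_simps)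
    then show ?thesis
      by (simp only: W_add[OF node_poly_in bergman_space_cmult[OF node_poly_in]] W_cmult[OF node_poly_in])
  qed
  then show ?case
    by (simp only:) (intro holomorphic_intros insert.IH holomorphic_on_subset[OF \<rho>_hol U_sub_cut_domain])
qed

lemma holomorphic_W_lagrange: "(\<lambda>\<alpha>. W (lagrange k \<alpha>) \<alpha>) holomorphic_on U"
proof -
  have "W (lagrange k \<alpha>) = (\<lambda>z. inverse (\<Prod>j\<in>-{k}. \<rho> k \<alpha> - \<rho> j \<alpha>) * W (node_poly 0 (-{k}) \<alpha>) z)" for \<alpha>
    unfolding lagrange_def[abs_def] by (rule W_cmult[OF node_poly_in])
  moreover have "(\<lambda>\<alpha>. inverse (\<Prod>j\<in>-{k}. \<rho> k \<alpha> - \<rho> j \<alpha>) * W (node_poly 0 (-{k}) \<alpha>) \<alpha>) holomorphic_on U"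
    by (intro holomorphic_intros holomorphic_W_node_poly holomorphic_on_subset[OF \<rho>_hol U_sub_cut_domain])
      (use fiber_U(2) in \<open>auto simp: inj_on_def\<close>)
  ultimately show ?thesis by simp
qed

lemma deriv_\<rho>_e: "\<alpha> \<in> U \<Longrightarrow> deriv (\<rho> e) \<alpha> = 1"
proof -
  assume \<alpha>: "\<alpha> \<in> U"
  have "((\<lambda>z. z) has_field_derivative 1) (at \<alpha>)" by (rule DERIV_ident)
  then have "(\<rho> e has_field_derivative 1) (at \<alpha>)"
    by (rule has_field_derivative_transform_within_open[OF _ U_ball(1) \<alpha>]) (simp add: \<rho>_e)
  then show ?thesis by (rule DERIV_imp_deriv)
qed

text \<open>The coefficients form the row of \<open>e\<close> in the transfer matrix, where
  \<open>\<rho> e\<close> is the identity with derivative 1; this row has norm 1 and is holomorphic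
  in \<alpha>, hence constant. The claim extends beyond \<open>U\<close> because it will be applied
  at points \<open>\<rho> i \<alpha>\<close>, which need not lie in \<open>U\<close>.\<close>

lemma W_representation:
  obtains s :: "'n \<Rightarrow> complex" where "(\<Sum>k\<in>UNIV. (norm (s k))\<^sup>2) = 1"
    "\<And>f \<alpha>. f \<in> bergman_space \<Longrightarrow> \<alpha> \<in> cut_domain \<Longrightarrow> W f \<alpha> = (\<Sum>k\<in>UNIV. s k * branch_vec f \<alpha> k)"
proof -
  \<comment> \<open>The division compensates the weight that \<open>branch_vec\<close> puts on the
    value at \<open>\<rho> k \<alpha>\<close>.\<close>
  define s where "s = (\<lambda>k \<alpha>. W (lagrange k \<alpha>) \<alpha> / deriv (\<rho> k) \<alpha>)"
  have hol: "s k holomorphic_on U" for k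
    unfolding s_def
    by (intro holomorphic_intros holomorphic_W_lagrange holomorphic_on_subset[OF holomorphic_deriv[OF \<rho>_hol cut_domain(1)] U_sub_cut_domain]
        deriv_\<rho>_nonzero)
  have unit: "(\<Sum>k\<in>UNIV. (norm (s k \<alpha>))\<^sup>2) = 1" if \<alpha>: "\<alpha> \<in> U" for \<alpha>
  proof -
    define M :: "complex^'n^'n" where "M = (\<chi> i k. deriv (\<rho> i) \<alpha> * W (lagrange k \<alpha>) (\<rho> i \<alpha>) / deriv (\<rho> k) \<alpha>)"
    have "unitary_matrix M"
    proof (rule transfer_matrix_unitary[OF \<alpha>])
      fix f i assume f: "f \<in> bergman_space"
      show "branch_vec (W f) \<alpha> i = (\<Sum>k\<in>UNIV. M $ i $ k * branch_vec f \<alpha> k)"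
        unfolding branch_vec_def W_lagrange[OF f \<alpha>] sum_distrib_left
        by (rule sum.cong) (use deriv_\<rho>_nonzero[OF \<alpha>] in \<open>simp_all add: M_def\<close>)
    qed
    from unitary_matrix_row[OF this, of e] show ?thesis
      by (simp add: M_def s_def \<rho>_e[OF \<alpha>] deriv_\<rho>_e[OF \<alpha>])
  qed
  obtain u where u: "u \<in> U" using U_ball by auto
  have const: "s k \<alpha> = s k u" if "\<alpha> \<in> U" for k \<alpha>
    by (rule holomorphic_unit_vector_constant[OF hol U_ball(1,2) unit that u])
  have rep: "W f \<alpha> = (\<Sum>k\<in>UNIV. s k u * branch_vec f \<alpha> k)" if f: "f \<in> bergman_space" and \<alpha>: "\<alpha> \<in> cut_domain" for f \<alpha>
  proof (rule analytic_continuation_open[OF U_ball(1) cut_domain(1) U_ball(3) cut_domain(2) U_sub_cut_domain _ _ _ \<alpha>])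
    show "W f holomorphic_on cut_domain"
      by (rule holomorphic_on_subset[OF bergman_space_holomorphic[OF W_in[OF f]] cut_domain(4)])
    have "(\<lambda>\<alpha>. f (\<rho> k \<alpha>)) holomorphic_on cut_domain" for k
    proof -
      have "\<rho> k ` cut_domain \<subseteq> ball 0 1" using \<rho>_cut_domain(1) by blast
      from holomorphic_on_compose_gen[OF \<rho>_hol bergman_space_holomorphic[OF f] this]
      show ?thesis by (simp add: o_def)
    qed
    then show "(\<lambda>\<alpha>. \<Sum>k\<in>UNIV. s k u * branch_vec f \<alpha> k) holomorphic_on cut_domain"
      unfolding branch_vec_def by (intro holomorphic_intros holomorphic_deriv \<rho>_hol cut_domain)
    fix z assume z: "z \<in> U"
    have "W f z = (\<Sum>k\<in>UNIV. f (\<rho> k z) * W (lagrange k z) z)"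
      using W_lagrange[OF f z, of e] by (simp add: \<rho>_e[OF z])
    also have "\<dots> = (\<Sum>k\<in>UNIV. s k z * branch_vec f z k)"
      by (rule sum.cong) (use deriv_\<rho>_nonzero[OF z] in \<open>simp_all add: s_def branch_vec_def\<close>)
    finally show "W f z = (\<Sum>k\<in>UNIV. s k u * branch_vec f z k)" using const[OF z] by simp
  qed
  show ?thesis by (rule that[OF unit[OF u] rep])
qed

text \<open>Evaluating the representation at \<open>\<rho> i \<alpha>\<close> turns
  \<open>\<rho> k (\<rho> i \<alpha>)\<close> into \<open>\<rho> (\<pi> i k) \<alpha>\<close>, and
  the chain rule gives the weight the same index. Reindexing by \<open>\<pi> i\<close> moves the
  permutation onto the coefficients as its inverse.\<close>

lemma adjoint_representation:
  "\<exists>r :: complex^'n. norm r = 1 \<and>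
    unitary_matrix (gamma_matrix \<rho> U r) \<and>
    (\<forall>\<alpha>\<in>U. \<forall>i.
       bergman_adjoint W (\<lambda>z. cnj (deriv (\<rho> i) \<alpha>) * bergman_kernel (\<rho> i \<alpha>) z) =
       (\<lambda>z. \<Sum>k\<in>UNIV. gamma_matrix \<rho> U r $ i $ k *
              (cnj (deriv (\<rho> k) \<alpha>) * bergman_kernel (\<rho> k \<alpha>) z)))"
proof -
  obtain s :: "'n \<Rightarrow> complex" where s: "(\<Sum>k\<in>UNIV. (norm (s k))\<^sup>2) = 1"
    "\<And>f \<alpha>. f \<in> bergman_space \<Longrightarrow> \<alpha> \<in> cut_domain \<Longrightarrow> W f \<alpha> = (\<Sum>k\<in>UNIV. s k * branch_vec f \<alpha> k)"
    by (rule W_representation) blast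
  \<comment> \<open>The conjugate appears because the kernels stand in the second, conjugate-linear
    slot of the inner product.\<close>
  define r :: "complex^'n" where "r = (\<chi> k. cnj (s k))"
  define M where "M = gamma_matrix \<rho> U r"
  have M: "M $ i $ k = cnj (s (inv (\<pi> i) k))" for i k
    by (simp add: M_def gamma_matrix_def r_def)
  have trans: "branch_vec (W f) \<alpha> i = (\<Sum>k\<in>UNIV. cnj (M $ i $ k) * branch_vec f \<alpha> k)"
    if f: "f \<in> bergman_space" and \<alpha>: "\<alpha> \<in> U" for f \<alpha> i
  proof -
    have "branch_vec (W f) \<alpha> i = (\<Sum>k\<in>UNIV. s k * (deriv (\<rho> k) (\<rho> i \<alpha>) * deriv (\<rho> i) \<alpha> * f (\<rho> k (\<rho> i \<alpha>))))"
      unfolding branch_vec_def[of "W f"] s(2)[OF f \<rho>_U_cut_domain[OF \<alpha>]] sum_distrib_left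
      by (rule sum.cong) (simp_all add: branch_vec_def)
    also have "\<dots> = (\<Sum>k\<in>UNIV. s k * branch_vec f \<alpha> (\<pi> i k))"
      by (simp add: deriv_\<pi>[OF \<alpha>] \<pi>[OF \<alpha>] branch_vec_def)
    \<comment> \<open>The substitution of \<open>\<pi> i k\<close> for \<open>k\<close>: the entry
      of \<open>M\<close> in row \<open>i\<close> and column \<open>\<pi> i k\<close> is
      \<open>cnj (s k)\<close>.\<close>
    also have "\<dots> = (\<Sum>k\<in>UNIV. cnj (M $ i $ k) * branch_vec f \<alpha> k)"
      by (rule sum.reindex_bij_betw[OF bij_\<pi>[of i], of "\<lambda>k. cnj (M $ i $ k) * branch_vec f \<alpha> k", symmetric, THEN sym, THEN trans[rotated]])
        (simp add: M bij_is_inj[OF bij_\<pi>])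
    finally show ?thesis .
  qed
  obtain u where u: "u \<in> U" using U_ball by auto
  \<comment> \<open>The matrix does not depend on \<alpha>, so one point \<open>u\<close> of
    \<open>U\<close> decides unitarity; the transfer matrix is the entrywise conjugate of
    \<open>M\<close>.\<close>
  have "unitary_matrix (\<chi> i k. cnj (M $ i $ k))"
    by (rule transfer_matrix_unitary[OF u]) (simp add: trans[OF _ u])
  from unitary_matrix_cnj[OF this] have "unitary_matrix M" by simp
  moreover have "norm r = 1"
    using s(1) by (simp add: norm_vec_def L2_set_def r_def)
  moreover have "bergman_adjoint W (\<lambda>z. cnj (deriv (\<rho> i) \<alpha>) * bergman_kernel (\<rho> i \<alpha>) z) =
       (\<lambda>z. \<Sum>k\<in>UNIV. M $ i $ k * (cnj (deriv (\<rho> k) \<alpha>) * bergman_kernel (\<rho> k \<alpha>) z))"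
    if \<alpha>: "\<alpha> \<in> U" for \<alpha> i
  proof (rule bergman_adjoint_eqI)
    note k_in = bergman_reproducing(1)[OF \<rho>_U(1)[OF \<alpha>]]
    note k_eq = bergman_reproducing(2)[OF \<rho>_U(1)[OF \<alpha>]]
    show "(\<lambda>z. \<Sum>k\<in>UNIV. M $ i $ k * (cnj (deriv (\<rho> k) \<alpha>) * bergman_kernel (\<rho> k \<alpha>) z)) \<in> bergman_space"
      by (intro bergman_space_sum bergman_space_cmult k_in)
    fix f assume f: "f \<in> bergman_space"
    \<comment> \<open>The one-point index set \<open>{()}\<close> specializes the rule for sums to a
      single scalar multiple.\<close>
    have inner: "bergman_inner g (\<lambda>z. cnj (deriv (\<rho> k) \<alpha>) * bergman_kernel (\<rho> k \<alpha>) z) = branch_vec g \<alpha> k"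
      if "g \<in> bergman_space" for g k
      using bergman_inner_sum_right[OF that, of "{()}" "\<lambda>_. bergman_kernel (\<rho> k \<alpha>)" "\<lambda>_. cnj (deriv (\<rho> k) \<alpha>)"]
      by (simp add: k_in k_eq[OF that] branch_vec_def)
    have "bergman_inner f (\<lambda>z. \<Sum>k\<in>UNIV. M $ i $ k * (cnj (deriv (\<rho> k) \<alpha>) * bergman_kernel (\<rho> k \<alpha>) z)) =
        (\<Sum>k\<in>UNIV. cnj (M $ i $ k) * branch_vec f \<alpha> k)"
      by (subst bergman_inner_sum_right[OF f]) (auto intro: bergman_space_cmult k_in simp: inner[OF f])
    then show "bergman_inner (W f) (\<lambda>z. cnj (deriv (\<rho> i) \<alpha>) * bergman_kernel (\<rho> i \<alpha>) z) =
        bergman_inner f (\<lambda>z. \<Sum>k\<in>UNIV. M $ i $ k * (cnj (deriv (\<rho> k) \<alpha>) * bergman_kernel (\<rho> k \<alpha>) z))"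
      unfolding inner[OF W_in[OF f]] trans[OF f \<alpha>] by simp
  qed
  ultimately show ?thesis unfolding M_def by blast
qed

end

theorem theorem6p1:
  fixes a :: "'n::finite \<Rightarrow> complex" and \<phi> :: "complex \<Rightarrow> complex"
    and U :: "complex set" and \<gamma> :: "real \<Rightarrow> complex"
    and e :: 'n and \<rho> :: "'n \<Rightarrow> complex \<Rightarrow> complex"
    and W :: "(complex \<Rightarrow> complex) \<Rightarrow> complex \<Rightarrow> complex"
  assumes "\<And>j. a j \<in> ball 0 1" and "\<phi> = blaschke a"
    and "small_invertible \<phi> U"
    and "orientation \<phi> U \<gamma> e \<rho>"
    and "bergman_unitary W"
    and "\<And>f. f \<in> bergman_space \<Longrightarrow> W (mult_operator \<phi> f) = mult_operator \<phi> (W f)"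
  shows "\<exists>r :: complex^'n. norm r = 1 \<and>
    unitary_matrix (gamma_matrix \<rho> U r) \<and>
    (\<forall>\<alpha>\<in>U. \<forall>i.
       bergman_adjoint W (\<lambda>z. cnj (deriv (\<rho> i) \<alpha>) * bergman_kernel (\<rho> i \<alpha>) z) =
       (\<lambda>z. \<Sum>k\<in>UNIV. gamma_matrix \<rho> U r $ i $ k *
              (cnj (deriv (\<rho> k) \<alpha>) * bergman_kernel (\<rho> k \<alpha>) z)))"
proof -
  interpret blaschke_unitary a \<phi> U \<gamma> e \<rho> W
    by unfold_locales (use assms in auto)
  show ?thesis by (rule adjoint_representation)
qed

end
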